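(* Let $G,H\in\mathbb{GS}$. If $G\sim H$ and both $G$ and $H$ are reduced, then $G$ and $H$ are identical (they have the same game tree with the same atoms in the same positions).
   Context: A scoring game is written $G=\langle G^{\mathcal L}\mid G^{\mathcal R}\rangle$, where each of $G^{\mathcal L}$ (Left options) and $G^{\mathcal R}$ (Right options) is either a finite nonempty set of scoring games or an atom $\emptyset^{s}$, $s\in\mathbb R$ (the player to move on that side cannot move and the game ends with score $s$); game trees are finite. An atom occurring in $G$ is an atom of $G$ or of any follower of $G$. $G$ is guaranteed if for every follower $K$ of $G$: if $K^{\mathcal L}=\emptyset^\ell$ then $\ell\le s$ for every atom $\emptyset^s$ occurring in $K$, and if $K^{\mathcal R}=\emptyset^r$ then $s\le r$ for every atom $\emptyset^s$ occurring in $K$; $\mathbb{GS}$ is the class of guaranteed games. Disjunctive sum $G+H$: Left options are $G^L+H$ and $G+H^L$, except if both are left-atomic with atoms $\emptyset^{\ell_1},\emptyset^{\ell_2}$, then $(G+H)^{\mathcal L}=\emptyset^{\ell_1+\ell_2}$; Right symmetric. Stops: $Ls(G)=\ell$ if $G^{\mathcal L}=\emptyset^\ell$, otherwise $\max_{G^L}Rs(G^L)$; $Rs(G)=r$ if $G^{\mathcal R}=\emptyset^r$, otherwise $\min_{G^R}Ls(G^R)$. $G\succcurlyeq H$ iff $Ls(G+X)\ge Ls(H+X)$ and $Rs(G+X)\ge Rs(H+X)$ for all $X\in\mathbb{GS}$; $G\sim H$ iff both $G\succcurlyeq H$ and $H\succcurlyeq G$. Conjugate $\overleftrightarrow{G}=\langle\overleftrightarrow{G^{\mathcal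 R}}\mid\overleftrightarrow{G^{\mathcal L}}\rangle$ (atom $\emptyset^s$ becomes $\emptyset^{-s}$); waiting moves $\widehat 0=\langle\emptyset^0\mid\emptyset^0\rangle$, $\widehat{k+1}=\langle\widehat k\mid\emptyset^0\rangle$, $-\widehat k=\overleftrightarrow{\widehat k}$; a real $x$ denotes $\langle\emptyset^x\mid\emptyset^x\rangle$. $\underline{Ls}(G)=\min_{k\ge0}Ls(G-\widehat k)$, $\underline{Rs}(G)=\min_{k\ge0}Rs(G-\widehat k)$. A Left option $A$ of $G$ is reversible through $B$ if $B$ is a Right option of $A$ with $G\succcurlyeq B$; it is atomic-reversible if moreover $B=\langle\emptyset^\ell\mid B^{\mathcal R}\rangle$ is left-atomic. The Left reductions are: (i) if $A,B\in G^{\mathcal L}$ are distinct with $B\succcurlyeq A$, delete $A$; (ii) if $A\in G^{\mathcal L}$ is reversible through $B$ with $B^{\mathcal L}$ a nonempty set, replace $A$ by the options in $B^{\mathcal L}$; (iii) if $A$ is atomic-reversible through $B=\langle\emptyset^\ell\mid B^{\mathcal R}\rangle$: if $\underline{Ls}(G)=\underline{Rs}(G^L)$ for some other $G^L\in G^{\mathcal L}$, delete $A$; if instead $\underline{Ls}(G)=\underline{Rs}(A)>\underline{Rs}(G^L)$ for all other $G^L$, replace $A$ by $\ell-\widehat{n+1}$ where $n$ is the least nonnegative integer with $G\succcurlyeq\ell-\widehat n$; (iv) in the latter situation, if $A$ is the only Left option and $\langle\emptyset^\ell\mid G^{\mathcal R}\rangle\in\mathbb{GS}$, replace $G$ by $\langle\emptyset^\ell\mid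 G^{\mathcal R}\rangle$. Right reductions are the symmetric ones (Left and Right interchanged). Each reduction yields a game equivalent to $G$. $G$ is reduced if no reduction can be applied to $G$, or to any follower of $G$, so as to obtain an equivalent game with different sets of options. *)

theory Defs
  imports Complex_Main "HOL-Library.FSet"
begin

text \<open>
  The type admits the empty option set, which is not a scoring game; it is excluded by
  \<open>scoring_game\<close> below.  Options form a finite \<^emph>\<open>set\<close>, so equality of games
  is identity of game trees (with atoms).
\<close>

datatype game = Game (left: side) (right: side)
  and side = Atom real | Opts "game fset"

fun opts :: "side \<Rightarrow> game fset" where
  "opts (Atom s) = {||}"
| "opts (Opts A) = A"

abbreviation left_opts :: "game \<Rightarrow> game fset" where
  "left_opts G \<equiv> opts (left G)"

abbreviation right_opts :: "game \<Rightarrow> game fset" where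
  "right_opts G \<equiv> opts (right G)"

lemma size_opts: "A |\<in>| opts S \<Longrightarrow> size A < size S"
proof (cases S)
  case (Opts F)
  assume "A |\<in>| opts S"
  with Opts have A: "A \<in> fset F" by simp
  have "Suc (size A) \<le> (\<Sum>B \<in> fset F. Suc (size B))"
    using A by (intro member_le_sum) auto
  then show ?thesis using Opts by simp
qed simp

lemma size_left_opts: "A |\<in>| left_opts G \<Longrightarrow> size A < size G"
  using size_opts[of A "left G"] by (cases G) simp

lemma size_right_opts: "A |\<in>| right_opts G \<Longrightarrow> size A < size G"
  using size_opts[of A "right G"] by (cases G) simp

lemma fimage_cong_fundef [fundef_cong]:
  "A = B \<Longrightarrow> (\<And>x. x |\<in>| B \<Longrightarrow> f x = g x) \<Longrightarrow> f |`| A = g |`| B"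
  by (auto intro!: fset_eqI)

inductive_set followers :: "game \<Rightarrow> game set" for G :: game where
  self: "G \<in> followers G"
| left: "K \<in> followers G \<Longrightarrow> A |\<in>| left_opts K \<Longrightarrow> A \<in> followers G"
| right: "K \<in> followers G \<Longrightarrow> A |\<in>| right_opts K \<Longrightarrow> A \<in> followers G"

definition scoring_game :: "game \<Rightarrow> bool" where
  "scoring_game G \<longleftrightarrow>
     (\<forall>K \<in> followers G. left K \<noteq> Opts {||} \<and> right K \<noteq> Opts {||})"

definition atoms :: "game \<Rightarrow> real set" where
  "atoms G = {s. \<exists>K \<in> followers G. left K = Atom s \<or> right K = Atom s}"

definition GS :: "game set" where
  "GS = {G. scoring_game G \<and>
     (\<forall>K \<in> followers G.
        (\<forall>l. left K = Atom l \<longrightarrow> (\<forall>s \<in> atoms K. l \<le> s)) \<and>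
        (\<forall>r. right K = Atom r \<longrightarrow> (\<forall>s \<in> atoms K. s \<le> r)))}"

function gsum :: "game \<Rightarrow> game \<Rightarrow> game" (infixl \<open>\<oplus>\<close> 65) where
  "G \<oplus> H = Game
     (case (left G, left H) of
        (Atom a, Atom b) \<Rightarrow> Atom (a + b)
      | _ \<Rightarrow> Opts ((\<lambda>A. A \<oplus> H) |`| left_opts G |\<union>| (\<lambda>B. G \<oplus> B) |`| left_opts H))
     (case (right G, right H) of
        (Atom a, Atom b) \<Rightarrow> Atom (a + b)
      | _ \<Rightarrow> Opts ((\<lambda>A. A \<oplus> H) |`| right_opts G |\<union>| (\<lambda>B. G \<oplus> B) |`| right_opts H))"
  by auto
termination
  by (relation "measure (\<lambda>(G, H). size G + size H)") (auto dest: size_left_opts size_right_opts)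

declare gsum.simps [simp del]

function Ls :: "game \<Rightarrow> real" and Rs :: "game \<Rightarrow> real" where
  "Ls G = (case left G of Atom l \<Rightarrow> l | Opts A \<Rightarrow> Max (Rs ` fset A))"
| "Rs G = (case right G of Atom r \<Rightarrow> r | Opts A \<Rightarrow> Min (Ls ` fset A))"
  by pat_completeness auto
termination
  by (relation "measure (\<lambda>x. case x of Inl G \<Rightarrow> size G | Inr G \<Rightarrow> size G)")
     (auto intro: size_left_opts size_right_opts)

declare Ls.simps [simp del] Rs.simps [simp del]

definition game_ge :: "game \<Rightarrow> game \<Rightarrow> bool" (infix \<open>\<succeq>\<close> 50) where
  "G \<succeq> H \<longleftrightarrow> (\<forall>X \<in> GS. Ls (G \<oplus> X) \<ge> Ls (H \<oplus> X) \<and> Rs (G \<oplus> X) \<ge> Rs (H \<oplus> X))"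

definition game_equiv :: "game \<Rightarrow> game \<Rightarrow> bool" (infix \<open>\<sim>\<close> 50) where
  "G \<sim> H \<longleftrightarrow> G \<succeq> H \<and> H \<succeq> G"

primrec conj_game :: "game \<Rightarrow> game" and conj_side :: "side \<Rightarrow> side" where
  "conj_game (Game L R) = Game (conj_side R) (conj_side L)"
| "conj_side (Atom s) = Atom (- s)"
| "conj_side (Opts A) = Opts (conj_game |`| A)"

definition number :: "real \<Rightarrow> game" where
  "number x = Game (Atom x) (Atom x)"

primrec wait :: "nat \<Rightarrow> game" where
  "wait 0 = Game (Atom 0) (Atom 0)"
| "wait (Suc k) = Game (Opts {|wait k|}) (Atom 0)"

abbreviation neg_wait :: "nat \<Rightarrow> game" where
  "neg_wait k \<equiv> conj_game (wait k)"

text \<open>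
  The pass-allowed stops; the \<open>upper_\<close> versions are the Left-Right mirror images of the
  \<open>lower_\<close> versions.  The ranges below are finite for scoring games, as shown at the end of
  the theory, so the minima and maxima are attained.
\<close>

definition lower_Ls :: "game \<Rightarrow> real" where
  "lower_Ls G = Min (range (\<lambda>k. Ls (G \<oplus> neg_wait k)))"

definition lower_Rs :: "game \<Rightarrow> real" where
  "lower_Rs G = Min (range (\<lambda>k. Rs (G \<oplus> neg_wait k)))"

definition upper_Ls :: "game \<Rightarrow> real" where
  "upper_Ls G = Max (range (\<lambda>k. Ls (G \<oplus> wait k)))"

definition upper_Rs :: "game \<Rightarrow> real" where
  "upper_Rs G = Max (range (\<lambda>k. Rs (G \<oplus> wait k)))"

definition left_reversible :: "game \<Rightarrow> game \<Rightarrow> game \<Rightarrow> bool" where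
  "left_reversible G A B \<longleftrightarrow> A |\<in>| left_opts G \<and> B |\<in>| right_opts A \<and> G \<succeq> B"

definition right_reversible :: "game \<Rightarrow> game \<Rightarrow> game \<Rightarrow> bool" where
  "right_reversible G A B \<longleftrightarrow> A |\<in>| right_opts G \<and> B |\<in>| left_opts A \<and> B \<succeq> G"

definition left_atomic_reversible :: "game \<Rightarrow> game \<Rightarrow> game \<Rightarrow> real \<Rightarrow> bool" where
  "left_atomic_reversible G A B l \<longleftrightarrow> left_reversible G A B \<and> left B = Atom l"

definition right_atomic_reversible :: "game \<Rightarrow> game \<Rightarrow> game \<Rightarrow> real \<Rightarrow> bool" where
  "right_atomic_reversible G A B r \<longleftrightarrow> right_reversible G A B \<and> right B = Atom r"

inductive left_reduction :: "game \<Rightarrow> game \<Rightarrow> bool" for G :: game where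
  dominated:
    "left_reduction G (Game (Opts (left_opts G |-| {|A|})) (right G))"
    if "A |\<in>| left_opts G" "B |\<in>| left_opts G" "A \<noteq> B" "B \<succeq> A"
| reverse:
    "left_reduction G (Game (Opts ((left_opts G |-| {|A|}) |\<union>| F)) (right G))"
    if "left_reversible G A B" "left B = Opts F" "F \<noteq> {||}"
| atomic_delete:
    "left_reduction G (Game (Opts (left_opts G |-| {|A|})) (right G))"
    if "left_atomic_reversible G A B l"
       "C |\<in>| left_opts G" "C \<noteq> A" "lower_Ls G = lower_Rs C"
| atomic_replace:
    "left_reduction G
       (Game (Opts (finsert (number l \<oplus> neg_wait (n + 1)) (left_opts G |-| {|A|}))) (right G))"
    if "left_atomic_reversible G A B l"
       "lower_Ls G = lower_Rs A"
       "\<And>C. C |\<in>| left_opts G \<Longrightarrow> C \<noteq> A \<Longrightarrow> lower_Rs A > lower_Rs C"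
       "G \<succeq> number l \<oplus> neg_wait n"
       "\<And>m. G \<succeq> number l \<oplus> neg_wait m \<Longrightarrow> n \<le> m"
| atomic_empty:
    "left_reduction G (Game (Atom l) (right G))"
    if "left_atomic_reversible G A B l"
       "lower_Ls G = lower_Rs A"
       "left_opts G = {|A|}"
       "Game (Atom l) (right G) \<in> GS"

inductive right_reduction :: "game \<Rightarrow> game \<Rightarrow> bool" for G :: game where
  dominated:
    "right_reduction G (Game (left G) (Opts (right_opts G |-| {|A|})))"
    if "A |\<in>| right_opts G" "B |\<in>| right_opts G" "A \<noteq> B" "A \<succeq> B"
| reverse:
    "right_reduction G (Game (left G) (Opts ((right_opts G |-| {|A|}) |\<union>| F)))"
    if "right_reversible G A B" "right B = Opts F" "F \<noteq> {||}"
| atomic_delete: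
    "right_reduction G (Game (left G) (Opts (right_opts G |-| {|A|})))"
    if "right_atomic_reversible G A B r"
       "C |\<in>| right_opts G" "C \<noteq> A" "upper_Rs G = upper_Ls C"
| atomic_replace:
    "right_reduction G
       (Game (left G) (Opts (finsert (number r \<oplus> wait (n + 1)) (right_opts G |-| {|A|}))))"
    if "right_atomic_reversible G A B r"
       "upper_Rs G = upper_Ls A"
       "\<And>C. C |\<in>| right_opts G \<Longrightarrow> C \<noteq> A \<Longrightarrow> upper_Ls A < upper_Ls C"
       "number r \<oplus> wait n \<succeq> G"
       "\<And>m. number r \<oplus> wait m \<succeq> G \<Longrightarrow> n \<le> m"
| atomic_empty:
    "right_reduction G (Game (left G) (Atom r))"
    if "right_atomic_reversible G A B r"
       "upper_Rs G = upper_Ls A"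
       "right_opts G = {|A|}"
       "Game (left G) (Atom r) \<in> GS"

definition reduced :: "game \<Rightarrow> bool" where
  "reduced G \<longleftrightarrow>
     (\<forall>K \<in> followers G. \<not> (\<exists>K'. (left_reduction K K' \<or> right_reduction K K') \<and> K' \<sim> K \<and> K' \<noteq> K))"

lemma left_gsum:
  "left (G \<oplus> H) = (case (left G, left H) of (Atom a, Atom b) \<Rightarrow> Atom (a + b)
     | _ \<Rightarrow> Opts ((\<lambda>A. A \<oplus> H) |`| left_opts G |\<union>| (\<lambda>B. G \<oplus> B) |`| left_opts H))"
  by (subst gsum.simps) simp

lemma right_gsum:
  "right (G \<oplus> H) = (case (right G, right H) of (Atom a, Atom b) \<Rightarrow> Atom (a + b)
     | _ \<Rightarrow> Opts ((\<lambda>A. A \<oplus> H) |`| right_opts G |\<union>| (\<lambda>B. G \<oplus> B) |`| right_opts H))"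
  by (subst gsum.simps) simp

lemma followers_trans: "K \<in> followers A \<Longrightarrow> A \<in> followers G \<Longrightarrow> K \<in> followers G"
  by (induction rule: followers.induct) (auto intro: followers.intros)

lemma followers_left: "A |\<in>| left_opts G \<Longrightarrow> A \<in> followers G"
  and followers_right: "A |\<in>| right_opts G \<Longrightarrow> A \<in> followers G"
  by (auto intro: followers.intros)

lemma followers_unfold:
  "followers G = insert G (\<Union>A \<in> fset (left_opts G |\<union>| right_opts G). followers A)"
proof (intro equalityI subsetI)
  fix K assume "K \<in> followers G"
  then show "K \<in> insert G (\<Union>A \<in> fset (left_opts G |\<union>| right_opts G). followers A)"
    by induction (auto intro: followers.intros)
qed (auto intro: followers.self followers_trans followers_left followers_right)

lemma finite_followers: "finite (followers G)"
proof (induction G rule: measure_induct_rule[of size])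
  case (less G)
  then show ?case
    by (subst followers_unfold) (auto dest: size_left_opts size_right_opts)
qed

lemma finite_atoms: "finite (atoms G)"
proof (rule finite_subset)
  show "atoms G \<subseteq> (\<lambda>K. case left K of Atom s \<Rightarrow> s) ` followers G \<union> (\<lambda>K. case right K of Atom s \<Rightarrow> s) ` followers G"
    unfolding atoms_def by (force split: side.splits)
qed (simp add: finite_followers)

lemma atoms_follower: "K \<in> followers G \<Longrightarrow> atoms K \<subseteq> atoms G"
  unfolding atoms_def using followers_trans by blast

lemma scoring_game_follower: "K \<in> followers G \<Longrightarrow> scoring_game G \<Longrightarrow> scoring_game K"
  unfolding scoring_game_def using followers_trans by blast

lemma stops_sum_in_atoms:
  assumes "scoring_game G" "scoring_game W" "atoms W \<subseteq> {0}"
  shows "Ls (G \<oplus> W) \<in> atoms G \<and> Rs (G \<oplus> W) \<in> atoms G"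
  using assms
proof (induction "size G + size W" arbitrary: G W rule: less_induct)
  case less
  have G: "left G \<noteq> Opts {||}" "right G \<noteq> Opts {||}"
    and W: "left W \<noteq> Opts {||}" "right W \<noteq> Opts {||}"
    using less.prems by (auto simp: scoring_game_def intro: followers.self)
  have W0: "left W = Atom s \<Longrightarrow> s = 0" "right W = Atom s \<Longrightarrow> s = 0" for s
    using less.prems(3) by (auto simp: atoms_def intro: followers.self)
  have Gs: "left G = Atom s \<Longrightarrow> s \<in> atoms G" "right G = Atom s \<Longrightarrow> s \<in> atoms G" for s
    by (auto simp: atoms_def intro: followers.self)
  have IHG: "Ls (A \<oplus> W) \<in> atoms G \<and> Rs (A \<oplus> W) \<in> atoms G"
    if "A |\<in>| left_opts G \<or> A |\<in>| right_opts G" for A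
  proof -
    have "A \<in> followers G" "size A < size G"
      using that by (auto intro: followers_left followers_right size_left_opts size_right_opts)
    then show ?thesis
      using less.hyps[of A W] less.prems atoms_follower[of A G] scoring_game_follower[of A G] by auto
  qed
  have IHW: "Ls (G \<oplus> A) \<in> atoms G \<and> Rs (G \<oplus> A) \<in> atoms G"
    if "A |\<in>| left_opts W \<or> A |\<in>| right_opts W" for A
  proof -
    have "A \<in> followers W" "size A < size W"
      using that by (auto intro: followers_left followers_right size_left_opts size_right_opts)
    then show ?thesis
      using less.hyps[of G A] less.prems atoms_follower[of A W] scoring_game_follower[of A W] by auto
  qed
  have mx: "Max S \<in> T" and mn: "Min S \<in> T" if "finite S" "S \<noteq> {}" "S \<subseteq> T" for S T :: "real set"
    using that Max_in Min_in by blast+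
  have "Ls (G \<oplus> W) \<in> atoms G"
    using G W W0 Gs IHG IHW
    by (subst Ls.simps) (auto simp: left_gsum split: side.splits intro!: mx)
  moreover have "Rs (G \<oplus> W) \<in> atoms G"
    using G W W0 Gs IHG IHW
    by (subst Rs.simps) (auto simp: right_gsum split: side.splits intro!: mn)
  ultimately show ?case ..
qed

lemma wait_props:
  "scoring_game (wait k) \<and> atoms (wait k) \<subseteq> {0}"
  "scoring_game (neg_wait k) \<and> atoms (neg_wait k) \<subseteq> {0}"
proof -
  have "K \<in> followers (wait k) \<Longrightarrow> left K \<noteq> Opts {||} \<and> right K = Atom 0 \<and> (\<forall>s. left K = Atom s \<longrightarrow> s = 0)" for K
    by (induction k) (subst (asm) followers_unfold; auto)+
  then show "scoring_game (wait k) \<and> atoms (wait k) \<subseteq> {0}"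
    by (auto simp: scoring_game_def atoms_def)
  have "K \<in> followers (neg_wait k) \<Longrightarrow> right K \<noteq> Opts {||} \<and> left K = Atom 0 \<and> (\<forall>s. right K = Atom s \<longrightarrow> s = 0)" for K
    by (induction k) (subst (asm) followers_unfold; auto)+
  then show "scoring_game (neg_wait k) \<and> atoms (neg_wait k) \<subseteq> {0}"
    by (auto simp: scoring_game_def atoms_def)
qed

lemma finite_range_pass_allowed:
  assumes "scoring_game G"
  shows "finite (range (\<lambda>k. Ls (G \<oplus> neg_wait k)))" "finite (range (\<lambda>k. Rs (G \<oplus> neg_wait k)))"
    "finite (range (\<lambda>k. Ls (G \<oplus> wait k)))" "finite (range (\<lambda>k. Rs (G \<oplus> wait k)))"
  using stops_sum_in_atoms[OF assms] wait_props
  by (auto intro!: finite_subset[OF _ finite_atoms[of G]])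

end

theory Submission
  imports Defs
begin

text \<open>
  If \<open>G \<succeq> H\<close>, then every Left option \<open>A\<close> of \<open>H\<close> is answered, either by a Left option
  \<open>C \<succeq> A\<close> of \<open>G\<close> or by a Right option \<open>B\<close> of \<open>A\<close> with \<open>G \<succeq> B\<close>: otherwise separating contexts
  for the finitely many failing comparisons can be glued into one game \<open>T\<close> with
  \<open>Ls (G \<oplus> T) < 0 < Rs (A \<oplus> T)\<close>.  Together with inequalities between pass-allowed stops in the atomic
  cases, the existence of such answers is also sufficient for \<open>G \<succeq> H\<close>, because a guaranteed game
  whose Left side is the atom \<open>x\<close> is at least \<open>x\<close> minus a long waiting move.  Hence every reduction
  yields an equivalent game.

  In a reduced game an option is therefore either not reversible, or it is the one waiting option
  \<open>l - (n + 1)\<close> whose \<open>l\<close> and \<open>n\<close> depend only on the equivalence class.  For equivalent reduced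
  games the answers pair up the non-reversible options, which are equal by induction, and the
  pass-allowed stop detects whether the waiting option is present.  What remains is an atom
  on one side against a lone waiting option on the other, and this is excluded by reduction (iv).
\<close>

subsection \<open>Sums, conjugates and stops\<close>

text \<open>\<open>opts\<close> yields \<open>{||}\<close> both for an atom and for the empty option
  set, so equality of atoms has to be checked on its own.\<close>

lemma side_eqI:
  assumes "\<And>s. S = Atom s \<longleftrightarrow> T = Atom s" "opts S = opts T"
  shows "S = T"
proof (cases "\<exists>s. S = Atom s")
  case False
  then have "\<exists>A. S = Opts A" "\<exists>B. T = Opts B"
    using assms(1) side.exhaust by metis+
  with assms(2) show ?thesis by auto
qed (use assms(1) in auto)

lemma left_gsum_eq_Atom:
  "left (G \<oplus> H) = Atom s \<longleftrightarrow> (\<exists>a b. left G = Atom a \<and> left H = Atom b \<and> s = a + b)"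
  by (auto simp: left_gsum split: side.splits)

lemma right_gsum_eq_Atom:
  "right (G \<oplus> H) = Atom s \<longleftrightarrow> (\<exists>a b. right G = Atom a \<and> right H = Atom b \<and> s = a + b)"
  by (auto simp: right_gsum split: side.splits)

lemma left_opts_gsum:
  "left_opts (G \<oplus> H) = (\<lambda>A. A \<oplus> H) |`| left_opts G |\<union>| (\<lambda>B. G \<oplus> B) |`| left_opts H"
  by (auto simp: left_gsum split: side.splits)

lemma right_opts_gsum:
  "right_opts (G \<oplus> H) = (\<lambda>A. A \<oplus> H) |`| right_opts G |\<union>| (\<lambda>B. G \<oplus> B) |`| right_opts H"
  by (auto simp: right_gsum split: side.splits)

lemma gsum_commute: "G \<oplus> H = H \<oplus> G"
proof (induction "size G + size H" arbitrary: G H rule: less_induct)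
  case less
  have IH: "A \<oplus> H = H \<oplus> A" if "size A < size G" for A
    using less[of A H] that by simp
  have IH': "G \<oplus> A = A \<oplus> G" if "size A < size H" for A
    using less[of G A] that by simp
  have *: "(\<lambda>A. A \<oplus> H) |`| F = (\<lambda>A. H \<oplus> A) |`| F" if "\<And>A. A |\<in>| F \<Longrightarrow> size A < size G" for F
    using that IH by (intro fset.map_cong refl) auto
  have **: "(\<lambda>A. G \<oplus> A) |`| F = (\<lambda>A. A \<oplus> G) |`| F" if "\<And>A. A |\<in>| F \<Longrightarrow> size A < size H" for F
    using that IH' by (intro fset.map_cong refl) auto
  show ?case
  proof (intro game.expand conjI side_eqI)
    show "left_opts (G \<oplus> H) = left_opts (H \<oplus> G)"
      unfolding left_opts_gsum by (simp add: * ** size_left_opts funion_commute)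
    show "right_opts (G \<oplus> H) = right_opts (H \<oplus> G)"
      unfolding right_opts_gsum by (simp add: * ** size_right_opts funion_commute)
  next
    show "left (G \<oplus> H) = Atom s \<longleftrightarrow> left (H \<oplus> G) = Atom s" for s
      by (cases "left G"; cases "left H") (auto simp: left_gsum)
    show "right (G \<oplus> H) = Atom s \<longleftrightarrow> right (H \<oplus> G) = Atom s" for s
      by (cases "right G"; cases "right H") (auto simp: right_gsum)
  qed
qed

lemma gsum_assoc: "(G \<oplus> H) \<oplus> J = G \<oplus> (H \<oplus> J)"
proof (induction "size G + size H + size J" arbitrary: G H J rule: less_induct)
  case less
  have *: "(\<lambda>A. (A \<oplus> H) \<oplus> J) |`| F = (\<lambda>A. A \<oplus> (H \<oplus> J)) |`| F"
    if "\<And>A. A |\<in>| F \<Longrightarrow> size A < size G" for F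
    using that less by (intro fset.map_cong refl) auto
  have **: "(\<lambda>A. (G \<oplus> A) \<oplus> J) |`| F = (\<lambda>A. G \<oplus> (A \<oplus> J)) |`| F"
    if "\<And>A. A |\<in>| F \<Longrightarrow> size A < size H" for F
    using that less by (intro fset.map_cong refl) auto
  have ***: "(\<lambda>A. (G \<oplus> H) \<oplus> A) |`| F = (\<lambda>A. G \<oplus> (H \<oplus> A)) |`| F"
    if "\<And>A. A |\<in>| F \<Longrightarrow> size A < size J" for F
    using that less by (intro fset.map_cong refl) auto
  show ?case
  proof (intro game.expand conjI side_eqI)
    show "left_opts ((G \<oplus> H) \<oplus> J) = left_opts (G \<oplus> (H \<oplus> J))"
      unfolding left_opts_gsum
      by (simp add: * ** *** size_left_opts funion_assoc fimage_funion fset.map_comp comp_def)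
    show "right_opts ((G \<oplus> H) \<oplus> J) = right_opts (G \<oplus> (H \<oplus> J))"
      unfolding right_opts_gsum
      by (simp add: * ** *** size_right_opts funion_assoc fimage_funion fset.map_comp comp_def)
  next
    show "left ((G \<oplus> H) \<oplus> J) = Atom s \<longleftrightarrow> left (G \<oplus> (H \<oplus> J)) = Atom s" for s
      by (cases "left G"; cases "left H"; cases "left J") (auto simp: left_gsum)
    show "right ((G \<oplus> H) \<oplus> J) = Atom s \<longleftrightarrow> right (G \<oplus> (H \<oplus> J)) = Atom s" for s
      by (cases "right G"; cases "right H"; cases "right J") (auto simp: right_gsum)
  qed
qed

section \<open>Conjugation as Left-Right symmetry\<close>

lemma left_conj_game [simp]: "left (conj_game G) = conj_side (right G)"
  and right_conj_game [simp]: "right (conj_game G) = conj_side (left G)"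
  by (cases G; simp)+

lemma opts_conj_side [simp]: "opts (conj_side S) = conj_game |`| opts S"
  by (cases S) auto

lemma conj_side_eq_Atom [simp]: "conj_side S = Atom s \<longleftrightarrow> S = Atom (- s)"
  by (cases S) auto

lemma conj_side_eq_empty [simp]: "conj_side S = Opts {||} \<longleftrightarrow> S = Opts {||}"
  by (cases S) auto

lemma conj_conj_game [simp]: "conj_game (conj_game G) = G"
  and conj_conj_side [simp]: "conj_side (conj_side S) = S"
proof (induction G and S)
  case (Opts F)
  then have "(\<lambda>A. conj_game (conj_game A)) |`| F = id |`| F"
    by (intro fset.map_cong refl) auto
  then show ?case
    by (simp add: fset.map_comp comp_def)
qed auto

lemma conj_game_eq_iff [simp]: "conj_game G = conj_game H \<longleftrightarrow> G = H"
  by (metis conj_conj_game)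

lemma conj_game_gsum: "conj_game (G \<oplus> H) = conj_game G \<oplus> conj_game H"
proof (induction "size G + size H" arbitrary: G H rule: less_induct)
  case less
  have *: "(\<lambda>A. conj_game (A \<oplus> H)) |`| F = (\<lambda>A. conj_game A \<oplus> conj_game H) |`| F"
    if "\<And>A. A |\<in>| F \<Longrightarrow> size A < size G" for F
    using that less by (intro fset.map_cong refl) auto
  have **: "(\<lambda>A. conj_game (G \<oplus> A)) |`| F = (\<lambda>A. conj_game G \<oplus> conj_game A) |`| F"
    if "\<And>A. A |\<in>| F \<Longrightarrow> size A < size H" for F
    using that less by (intro fset.map_cong refl) auto
  show ?case
  proof (intro game.expand conjI side_eqI)
    show "left_opts (conj_game (G \<oplus> H)) = left_opts (conj_game G \<oplus> conj_game H)"
      by (simp add: left_opts_gsum right_opts_gsum * ** size_right_opts fimage_funion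
          fset.map_comp comp_def)
    show "right_opts (conj_game (G \<oplus> H)) = right_opts (conj_game G \<oplus> conj_game H)"
      by (simp add: left_opts_gsum right_opts_gsum * ** size_left_opts fimage_funion
          fset.map_comp comp_def)
  next
    show "left (conj_game (G \<oplus> H)) = Atom s \<longleftrightarrow> left (conj_game G \<oplus> conj_game H) = Atom s" for s
      by (cases "right G"; cases "right H") (auto simp: left_gsum right_gsum)
    show "right (conj_game (G \<oplus> H)) = Atom s \<longleftrightarrow> right (conj_game G \<oplus> conj_game H) = Atom s" for s
      by (cases "left G"; cases "left H") (auto simp: left_gsum right_gsum)
  qed
qed

lemma followers_conj_game: "followers (conj_game G) = conj_game ` followers G"
proof -
  have *: "K \<in> followers (conj_game G) \<Longrightarrow> conj_game K \<in> followers G" for K G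
  proof (induction rule: followers.induct)
    case (left K A)
    then have "conj_game A |\<in>| right_opts (conj_game K)" by auto
    with left.IH show ?case by (rule followers.right)
  next
    case (right K A)
    then have "conj_game A |\<in>| left_opts (conj_game K)" by auto
    with right.IH show ?case by (rule followers.left)
  qed (simp add: followers.self)
  show ?thesis
    using *[of _ G] *[of _ "conj_game G"] by (force simp: image_iff)
qed

lemma atoms_conj_game: "atoms (conj_game G) = uminus ` atoms G"
  unfolding atoms_def followers_conj_game
  by (auto simp: image_iff) (metis add.inverse_inverse)+

lemma conj_game_GS [simp]: "conj_game G \<in> GS \<longleftrightarrow> G \<in> GS"
proof -
  have "conj_game G \<in> GS" if "G \<in> GS" for G
    using that unfolding GS_def scoring_game_def
    by (force simp: followers_conj_game atoms_conj_game)
  from this[of G] this[of "conj_game G"] show ?thesis by auto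
qed

lemma scoring_game_conj_game [simp]: "scoring_game (conj_game G) \<longleftrightarrow> scoring_game G"
  by (auto simp: scoring_game_def followers_conj_game)

section \<open>Closure properties of scoring and guaranteed games\<close>

lemma scoring_game_sides:
  assumes "scoring_game G"
  shows "left G \<noteq> Opts {||}" "right G \<noteq> Opts {||}"
  using assms by (auto simp: scoring_game_def intro: followers.self)

lemma scoring_game_left_opts: "scoring_game G \<Longrightarrow> A |\<in>| left_opts G \<Longrightarrow> scoring_game A"
  and scoring_game_right_opts: "scoring_game G \<Longrightarrow> A |\<in>| right_opts G \<Longrightarrow> scoring_game A"
  by (meson followers_left followers_right scoring_game_follower)+

lemma GS_scoring_game: "G \<in> GS \<Longrightarrow> scoring_game G"
  by (simp add: GS_def)

lemma GS_follower: "K \<in> followers G \<Longrightarrow> G \<in> GS \<Longrightarrow> K \<in> GS"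
  unfolding GS_def using followers_trans scoring_game_follower by blast

lemma GS_left_opts: "G \<in> GS \<Longrightarrow> A |\<in>| left_opts G \<Longrightarrow> A \<in> GS"
  and GS_right_opts: "G \<in> GS \<Longrightarrow> A |\<in>| right_opts G \<Longrightarrow> A \<in> GS"
  by (meson followers_left followers_right GS_follower)+

lemma GS_left_Atom: "G \<in> GS \<Longrightarrow> left G = Atom l \<Longrightarrow> s \<in> atoms G \<Longrightarrow> l \<le> s"
  and GS_right_Atom: "G \<in> GS \<Longrightarrow> right G = Atom r \<Longrightarrow> s \<in> atoms G \<Longrightarrow> s \<le> r"
  unfolding GS_def using followers.self by blast+

lemma atoms_left_Atom: "left G = Atom s \<Longrightarrow> s \<in> atoms G"
  and atoms_right_Atom: "right G = Atom s \<Longrightarrow> s \<in> atoms G"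
  by (auto simp: atoms_def intro: followers.self)

lemma atoms_unfold:
  "atoms G = {s. left G = Atom s \<or> right G = Atom s}
     \<union> (\<Union>A \<in> fset (left_opts G |\<union>| right_opts G). atoms A)"
  unfolding atoms_def by (subst followers_unfold) auto

text \<open>Atom bounds have to be checked at the root only: any other follower lies below an option
  that is already guaranteed.\<close>

lemma GS_GameI:
  assumes "L \<noteq> Opts {||}" "R \<noteq> Opts {||}"
    and "\<And>A. A |\<in>| opts L \<Longrightarrow> A \<in> GS" "\<And>A. A |\<in>| opts R \<Longrightarrow> A \<in> GS"
    and "\<And>l s. L = Atom l \<Longrightarrow> s \<in> atoms (Game L R) \<Longrightarrow> l \<le> s"
    and "\<And>r s. R = Atom r \<Longrightarrow> s \<in> atoms (Game L R) \<Longrightarrow> s \<le> r"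
  shows "Game L R \<in> GS"
proof -
  have *: "K = Game L R \<or> (\<exists>A. A \<in> GS \<and> K \<in> followers A)" if "K \<in> followers (Game L R)" for K
    using that assms(3,4) by (subst (asm) followers_unfold) auto
  have "scoring_game (Game L R)"
    unfolding scoring_game_def
    using assms(1,2) * by (metis GS_follower GS_scoring_game game.sel scoring_game_sides)
  moreover have "(left K = Atom l \<longrightarrow> l \<le> s) \<and> (right K = Atom r \<longrightarrow> s \<le> r)"
    if "K \<in> followers (Game L R)" "s \<in> atoms K" for K l r s
    using *[OF that(1)] that(2) assms(5,6) GS_follower GS_left_Atom GS_right_Atom
    by (metis game.sel)
  ultimately show ?thesis
    by (auto simp: GS_def)
qed

lemma followers_gsum:
  "K \<in> followers (G \<oplus> H) \<Longrightarrow> \<exists>A \<in> followers G. \<exists>B \<in> followers H. K = A \<oplus> B"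
proof (induction rule: followers.induct)
  case (left K A)
  then show ?case
    by (auto simp: left_opts_gsum) (metis followers.left)+
next
  case (right K A)
  then show ?case
    by (auto simp: right_opts_gsum) (metis followers.right)+
qed (auto intro: followers.self)

lemma atoms_gsum:
  assumes "s \<in> atoms (G \<oplus> H)"
  obtains a b where "a \<in> atoms G" "b \<in> atoms H" "s = a + b"
  using assms followers_gsum
  unfolding atoms_def by (fastforce simp: left_gsum_eq_Atom right_gsum_eq_Atom)

lemma scoring_game_gsum:
  assumes "scoring_game G" "scoring_game H"
  shows "scoring_game (G \<oplus> H)"
proof -
  have "left (A \<oplus> B) \<noteq> Opts {||}" "right (A \<oplus> B) \<noteq> Opts {||}"
    if "A \<in> followers G" "B \<in> followers H" for A B
    using that assms by (auto simp: left_gsum right_gsum scoring_game_def split: side.splits)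
  then show ?thesis
    using followers_gsum by (fastforce simp: scoring_game_def)
qed

text \<open>A side of a sum is atomic only if both summands are atomic there. Each of the two atoms
  bounds the atoms of its own summand, and these bounds add up.\<close>

lemma gsum_GS:
  assumes "G \<in> GS" "H \<in> GS"
  shows "G \<oplus> H \<in> GS"
proof -
  have "(left (A \<oplus> B) = Atom l \<longrightarrow> l \<le> s) \<and> (right (A \<oplus> B) = Atom l \<longrightarrow> s \<le> l)"
    if "A \<in> followers G" "B \<in> followers H" "s \<in> atoms (A \<oplus> B)" for A B l s
  proof -
    have "A \<in> GS" "B \<in> GS" using that assms GS_follower by auto
    then show ?thesis
      using that(3) GS_left_Atom[of A] GS_left_Atom[of B] GS_right_Atom[of A] GS_right_Atom[of B]
      by (elim atoms_gsum) (force simp: left_gsum_eq_Atom right_gsum_eq_Atom intro: add_mono)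
  qed
  then show ?thesis
    using assms followers_gsum unfolding GS_def by (blast intro: scoring_game_gsum)
qed

lemma atoms_number: "atoms (number x) = {x}"
  by (subst atoms_unfold) (auto simp: number_def)

lemma number_GS: "number x \<in> GS"
  using atoms_number[of x] unfolding number_def by (auto intro!: GS_GameI)

lemma wait_GS: "wait n \<in> GS"
proof (induction n)
  case 0
  then show ?case
    using number_GS[of 0] by (simp add: number_def)
next
  case (Suc n)
  then show ?case
    using wait_props(1)[of "Suc n"] by (auto intro!: GS_GameI)
qed

lemma atoms_number_wait: "s \<in> atoms (number x \<oplus> wait n) \<Longrightarrow> s = x"
  and atoms_number_neg_wait: "s \<in> atoms (number x \<oplus> neg_wait n) \<Longrightarrow> s = x"
  using wait_props by (fastforce elim!: atoms_gsum simp: atoms_number)+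

lemma conj_game_number [simp]: "conj_game (number x) = number (- x)"
  by (simp add: number_def)

text \<open>Left is stuck at once, while Right can only count down. This shape decides how the
  waiting option of reduction (iii) can be answered.\<close>

lemma number_neg_wait:
  "left (number l \<oplus> neg_wait n) = Atom l"
  "right (number l \<oplus> neg_wait 0) = Atom l"
  "right (number l \<oplus> neg_wait (Suc n)) = Opts {|number l \<oplus> neg_wait n|}"
  by (cases n; simp add: left_gsum right_gsum number_def)+

section \<open>Stops and optimal first moves\<close>

lemma Rs_le_Ls: "A |\<in>| left_opts G \<Longrightarrow> Rs A \<le> Ls G"
  by (subst Ls.simps) (auto split: side.splits)

lemma Rs_le_Ls': "A |\<in>| right_opts G \<Longrightarrow> Rs G \<le> Ls A"
  by (subst Rs.simps) (auto split: side.splits)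

lemma Ls_Atom: "left G = Atom l \<Longrightarrow> Ls G = l"
  and Rs_Atom: "right G = Atom l \<Longrightarrow> Rs G = l"
  by (simp_all add: Ls.simps Rs.simps)

lemma Ls_attained:
  assumes "left G \<noteq> Opts {||}" "left_opts G \<noteq> {||}"
  shows "\<exists>A. A |\<in>| left_opts G \<and> Ls G = Rs A"
proof -
  obtain F where F: "left G = Opts F" using assms by (cases "left G") auto
  then have "Max (Rs ` fset F) \<in> Rs ` fset F" using assms by (intro Max_in) auto
  then show ?thesis using F by (auto simp: Ls.simps[of G])
qed

lemma Rs_attained:
  assumes "right G \<noteq> Opts {||}" "right_opts G \<noteq> {||}"
  shows "\<exists>A. A |\<in>| right_opts G \<and> Rs G = Ls A"
proof -
  obtain F where F: "right G = Opts F" using assms by (cases "right G") auto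
  then have "Min (Ls ` fset F) \<in> Ls ` fset F" using assms by (intro Min_in) auto
  then show ?thesis using F by (auto simp: Rs.simps[of G])
qed

lemma Ls_cases:
  assumes "scoring_game G"
  obtains (Atom) l where "left G = Atom l" "Ls G = l"
    | (Opts) A where "A |\<in>| left_opts G" "Ls G = Rs A"
proof (cases "left G")
  case (Opts F)
  then show ?thesis
    using Ls_attained[of G] scoring_game_sides[OF assms] that(2) by auto
qed (use that(1) in \<open>auto simp: Ls_Atom\<close>)

lemma Rs_cases:
  assumes "scoring_game G"
  obtains (Atom) r where "right G = Atom r" "Rs G = r"
    | (Opts) A where "A |\<in>| right_opts G" "Rs G = Ls A"
proof (cases "right G")
  case (Opts F)
  then show ?thesis
    using Rs_attained[of G] scoring_game_sides[OF assms] that(2) by auto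
qed (use that(1) in \<open>auto simp: Rs_Atom\<close>)

lemma Ls_Rs_conj_game:
  "scoring_game G \<Longrightarrow> Ls (conj_game G) = - Rs G \<and> Rs (conj_game G) = - Ls G"
proof (induction "size G" arbitrary: G rule: less_induct)
  case less
  have IH: "Ls (conj_game A) = - Rs A \<and> Rs (conj_game A) = - Ls A"
    if "A |\<in>| left_opts G \<or> A |\<in>| right_opts G" for A
    using that less size_left_opts size_right_opts scoring_game_left_opts scoring_game_right_opts
    by blast
  have scoring: "scoring_game (conj_game G)" using less.prems by simp
  have "Ls (conj_game G) \<le> - Rs G"
    using scoring by (cases rule: Ls_cases) (use IH Rs_le_Ls' in \<open>auto simp: Rs_Atom\<close>)
  moreover have "- Rs G \<le> Ls (conj_game G)"
    using less.prems
  proof (cases rule: Rs_cases)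
    case (Opts A)
    with IH[of A] Rs_le_Ls[of "conj_game A" "conj_game G"] show ?thesis by simp
  qed (simp add: Ls_Atom)
  moreover have "- Ls G \<le> Rs (conj_game G)"
    using scoring by (cases rule: Rs_cases) (use IH Rs_le_Ls in \<open>auto simp: Ls_Atom\<close>)
  moreover have "Rs (conj_game G) \<le> - Ls G"
    using less.prems
  proof (cases rule: Ls_cases)
    case (Opts A)
    with IH[of A] Rs_le_Ls'[of "conj_game A" "conj_game G"] show ?thesis by simp
  qed (simp add: Rs_Atom)
  ultimately show ?case by simp
qed

lemma Ls_conj_game: "scoring_game G \<Longrightarrow> Ls (conj_game G) = - Rs G"
  and Rs_conj_game: "scoring_game G \<Longrightarrow> Rs (conj_game G) = - Ls G"
  by (simp_all add: Ls_Rs_conj_game)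

text \<open>Exhibits an optimal first move of Left. Together with \<open>Ls_gsum_ge\<close>, which
  bounds an arbitrary Left move, it turns strategy arguments into case distinctions.\<close>

lemma Ls_gsum_cases:
  assumes "scoring_game G" "scoring_game H"
  obtains (Atom) a b where "left G = Atom a" "left H = Atom b" "Ls (G \<oplus> H) = a + b"
    | (left) A where "A |\<in>| left_opts G" "Ls (G \<oplus> H) = Rs (A \<oplus> H)"
    | (right) B where "B |\<in>| left_opts H" "Ls (G \<oplus> H) = Rs (G \<oplus> B)"
  using scoring_game_gsum[OF assms]
  by (cases rule: Ls_cases) (auto simp: left_gsum_eq_Atom left_opts_gsum intro: that)

lemma Rs_gsum_cases:
  assumes "scoring_game G" "scoring_game H"
  obtains (Atom) a b where "right G = Atom a" "right H = Atom b" "Rs (G \<oplus> H) = a + b"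
    | (left) A where "A |\<in>| right_opts G" "Rs (G \<oplus> H) = Ls (A \<oplus> H)"
    | (right) B where "B |\<in>| right_opts H" "Rs (G \<oplus> H) = Ls (G \<oplus> B)"
  using scoring_game_gsum[OF assms]
  by (cases rule: Rs_cases) (auto simp: right_gsum_eq_Atom right_opts_gsum intro: that)

lemma Ls_gsum_ge:
  "A |\<in>| left_opts G \<Longrightarrow> Rs (A \<oplus> H) \<le> Ls (G \<oplus> H)"
  "B |\<in>| left_opts H \<Longrightarrow> Rs (G \<oplus> B) \<le> Ls (G \<oplus> H)"
  by (auto intro!: Rs_le_Ls simp: left_opts_gsum)

lemma Rs_gsum_le:
  "A |\<in>| right_opts G \<Longrightarrow> Rs (G \<oplus> H) \<le> Ls (A \<oplus> H)"
  "B |\<in>| right_opts H \<Longrightarrow> Rs (G \<oplus> H) \<le> Ls (G \<oplus> B)"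
  by (auto intro!: Rs_le_Ls' simp: right_opts_gsum)

lemma stops_in_atoms: "scoring_game G \<Longrightarrow> Ls G \<in> atoms G \<and> Rs G \<in> atoms G"
proof (induction "size G" arbitrary: G rule: less_induct)
  case less
  have IH: "Ls A \<in> atoms G \<and> Rs A \<in> atoms G" if "A |\<in>| left_opts G \<or> A |\<in>| right_opts G" for A
    using that less size_left_opts size_right_opts scoring_game_left_opts scoring_game_right_opts
      atoms_follower followers_left followers_right by blast
  have "Ls G \<in> atoms G"
    using less.prems by (cases rule: Ls_cases) (use IH in \<open>auto intro: atoms_left_Atom\<close>)
  moreover have "Rs G \<in> atoms G"
    using less.prems by (cases rule: Rs_cases) (use IH in \<open>auto intro: atoms_right_Atom\<close>)
  ultimately show ?case ..
qed

text \<open>A number offers no move, so play proceeds in \<open>G\<close> alone and every final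
  score is shifted by \<open>c\<close>.\<close>

lemma stops_number_gsum:
  "scoring_game G \<Longrightarrow> Ls (number c \<oplus> G) = c + Ls G \<and> Rs (number c \<oplus> G) = c + Rs G"
proof (induction "size G" arbitrary: G rule: less_induct)
  case less
  have IH: "Ls (number c \<oplus> A) = c + Ls A \<and> Rs (number c \<oplus> A) = c + Rs A"
    if "A |\<in>| left_opts G \<or> A |\<in>| right_opts G" for A
    using that less size_left_opts size_right_opts scoring_game_left_opts scoring_game_right_opts
    by blast
  have no_opts: "left_opts (number c) = {||}" "right_opts (number c) = {||}"
    by (simp_all add: number_def)
  note scoring = GS_scoring_game[OF number_GS, of c] less.prems
  have "Ls (number c \<oplus> G) = c + Ls G"
  proof (rule antisym)
    show "Ls (number c \<oplus> G) \<le> c + Ls G"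
      using scoring by (cases rule: Ls_gsum_cases)
        (auto simp: no_opts Ls_Atom number_def[of c, symmetric] IH Rs_le_Ls, simp add: number_def Ls_Atom)
    show "c + Ls G \<le> Ls (number c \<oplus> G)"
      using less.prems
    proof (cases rule: Ls_cases)
      case (Atom l)
      then have "left (number c \<oplus> G) = Atom (c + l)" by (simp add: left_gsum number_def)
      with Atom show ?thesis by (simp add: Ls_Atom)
    next
      case (Opts A)
      with IH[of A] Ls_gsum_ge(2)[of A G "number c"] show ?thesis by simp
    qed
  qed
  moreover have "Rs (number c \<oplus> G) = c + Rs G"
  proof (rule antisym)
    show "c + Rs G \<le> Rs (number c \<oplus> G)"
      using scoring by (cases rule: Rs_gsum_cases)
        (auto simp: no_opts Rs_Atom IH Rs_le_Ls', simp add: number_def Rs_Atom)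
    show "Rs (number c \<oplus> G) \<le> c + Rs G"
      using less.prems
    proof (cases rule: Rs_cases)
      case (Atom l)
      then have "right (number c \<oplus> G) = Atom (c + l)" by (simp add: right_gsum number_def)
      with Atom show ?thesis by (simp add: Rs_Atom)
    next
      case (Opts A)
      with IH[of A] Rs_gsum_le(2)[of A G "number c"] show ?thesis by simp
    qed
  qed
  ultimately show ?case ..
qed

lemma stops_gsum_number:
  assumes "scoring_game G" "scoring_game X"
  shows "Ls (G \<oplus> (number c \<oplus> X)) = c + Ls (G \<oplus> X)"
    and "Rs (G \<oplus> (number c \<oplus> X)) = c + Rs (G \<oplus> X)"
proof -
  have "G \<oplus> (number c \<oplus> X) = number c \<oplus> (G \<oplus> X)"
    by (metis gsum_assoc gsum_commute)
  then show "Ls (G \<oplus> (number c \<oplus> X)) = c + Ls (G \<oplus> X)"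
    "Rs (G \<oplus> (number c \<oplus> X)) = c + Rs (G \<oplus> X)"
    by (simp_all add: stops_number_gsum scoring_game_gsum assms)
qed

lemma game_ge_refl: "G \<succeq> G"
  by (simp add: game_ge_def)

lemma game_ge_trans: "G \<succeq> H \<Longrightarrow> H \<succeq> J \<Longrightarrow> G \<succeq> J"
  unfolding game_ge_def by (meson order_trans)

lemma conj_game_ge_conj_game:
  assumes "scoring_game G" "scoring_game H"
  shows "conj_game G \<succeq> conj_game H \<longleftrightarrow> H \<succeq> G"
proof -
  have *: "Ls (conj_game K \<oplus> X) = - Rs (K \<oplus> conj_game X)"
    "Rs (conj_game K \<oplus> X) = - Ls (K \<oplus> conj_game X)"
    if "scoring_game K" "X \<in> GS" for K X
    using that Ls_Rs_conj_game[of "K \<oplus> conj_game X"]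
    by (simp_all add: conj_game_gsum scoring_game_gsum GS_scoring_game)
  show ?thesis
    unfolding game_ge_def using assms
    by (auto simp: *) (metis conj_conj_game conj_game_GS)+
qed

lemma conj_game_equiv_conj_game:
  assumes "scoring_game G" "scoring_game H"
  shows "conj_game G \<sim> conj_game H \<longleftrightarrow> G \<sim> H"
  using assms by (auto simp: game_equiv_def conj_game_ge_conj_game)

subsection \<open>Separating contexts\<close>

lemma atoms_bound: "\<exists>M. \<forall>s \<in> atoms G \<union> atoms H. - M < s \<and> s < M"
proof -
  have "finite (abs ` (atoms G \<union> atoms H))" by (simp add: finite_atoms)
  then obtain b where b: "\<And>s. s \<in> atoms G \<union> atoms H \<Longrightarrow> \<bar>s\<bar> \<le> b"
    by (metis bdd_above_finite bdd_above.E imageI)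
  have "- (b + 1) < s \<and> s < b + 1" if "s \<in> atoms G \<union> atoms H" for s
    using b[OF that] by auto
  then show ?thesis by blast
qed

text \<open>Stops are atoms, so moving to a number beyond all atoms settles the sign of the outcome.
  Such numbers serve as threats in the contexts below.\<close>

lemma stops_gsum_number_pos:
  assumes "scoring_game K" "\<And>s. s \<in> atoms K \<Longrightarrow> - M < s"
  shows "0 < Ls (K \<oplus> number M)" "0 < Rs (K \<oplus> number M)"
  using stops_number_gsum[OF assms(1), of M] stops_in_atoms[OF assms(1)] assms(2)[of "Ls K"] assms(2)[of "Rs K"]
  by (auto simp: gsum_commute[of K])

lemma stops_gsum_number_neg:
  assumes "scoring_game K" "\<And>s. s \<in> atoms K \<Longrightarrow> s < M"
  shows "Ls (K \<oplus> number (- M)) < 0" "Rs (K \<oplus> number (- M)) < 0"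
  using stops_number_gsum[OF assms(1), of "- M"] stops_in_atoms[OF assms(1)] assms(2)[of "Ls K"] assms(2)[of "Rs K"]
  by (auto simp: gsum_commute[of K])

lemma GS_Opts:
  assumes "L \<noteq> {||}" "R \<noteq> {||}" "\<And>A. A |\<in>| L |\<union>| R \<Longrightarrow> A \<in> GS"
  shows "Game (Opts L) (Opts R) \<in> GS"
  using assms by (intro GS_GameI) auto

text \<open>In \<open>T'\<close> Right can move to \<open>T\<close>, which restores the given
  separation. If Right moves in \<open>H\<close> instead, Left replies by taking the threat
  \<open>number M\<close>, so that deviation does not help.\<close>

lemma Rs_separation_of_Ls_separation:
  assumes "scoring_game G" "scoring_game H" "T \<in> GS" "Ls (G \<oplus> T) < 0" "0 < Ls (H \<oplus> T)"
  shows "\<exists>T' \<in> GS. Rs (G \<oplus> T') < 0 \<and> 0 < Rs (H \<oplus> T')"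
proof -
  obtain M where M: "\<forall>s \<in> atoms G \<union> atoms H. - M < s \<and> s < M"
    using atoms_bound by blast
  define T' where "T' = Game (Opts {|number M|}) (Opts {|T|})"
  have T': "T' \<in> GS"
    unfolding T'_def using assms(3) number_GS by (intro GS_Opts) auto
  have "Rs (G \<oplus> T') < 0"
    using Rs_gsum_le(2)[of T T' G] assms(4) by (simp add: T'_def)
  moreover have "0 < Rs (H \<oplus> T')"
    using assms(2) GS_scoring_game[OF T']
  proof (cases rule: Rs_gsum_cases)
    case (left A)
    then have "s \<in> atoms A \<Longrightarrow> - M < s" for s
      using M atoms_follower followers_right by blast
    then have "0 < Rs (A \<oplus> number M)"
      using left assms(2) scoring_game_right_opts by (blast intro: stops_gsum_number_pos)
    also have "\<dots> \<le> Ls (A \<oplus> T')"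
      by (rule Ls_gsum_ge) (simp add: T'_def)
    finally show ?thesis using left by simp
  qed (use assms(5) in \<open>auto simp: T'_def\<close>)
  ultimately show ?thesis using T' by blast
qed

lemma Ls_separation_of_Rs_separation:
  assumes "scoring_game G" "scoring_game H" "T \<in> GS" "Rs (G \<oplus> T) < 0" "0 < Rs (H \<oplus> T)"
  shows "\<exists>T' \<in> GS. Ls (G \<oplus> T') < 0 \<and> 0 < Ls (H \<oplus> T')"
proof -
  have conj: "Ls (conj_game K \<oplus> conj_game X) = - Rs (K \<oplus> X)"
    "Rs (conj_game K \<oplus> conj_game X) = - Ls (K \<oplus> X)" if "scoring_game K" "X \<in> GS" for K X
    using that Ls_Rs_conj_game[of "K \<oplus> X"]
    by (simp_all add: conj_game_gsum scoring_game_gsum GS_scoring_game)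
  \<comment> \<open>Conjugation negates stops, so \<open>G\<close> and \<open>H\<close> exchange
    roles.\<close>
  obtain T' where T': "T' \<in> GS" "Rs (conj_game H \<oplus> T') < 0" "0 < Rs (conj_game G \<oplus> T')"
    using Rs_separation_of_Ls_separation[of "conj_game H" "conj_game G" "conj_game T"] assms
    by (auto simp: conj)
  then show ?thesis
    using conj(2)[of H "conj_game T'"] conj(2)[of G "conj_game T'"] assms(1,2)
    by (intro bexI[of _ "conj_game T'"]) auto
qed

text \<open>A failing comparison gives a strict gap at one of the two stops. A number shifts zero
  into the gap, and the two conversions above carry the separation over to the other stop.\<close>

lemma separation:
  assumes "scoring_game G" "scoring_game H" "\<not> G \<succeq> H"
  shows "\<exists>T \<in> GS. Ls (G \<oplus> T) < 0 \<and> 0 < Ls (H \<oplus> T)"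
    and "\<exists>T \<in> GS. Rs (G \<oplus> T) < 0 \<and> 0 < Rs (H \<oplus> T)"
proof -
  have shift: "\<exists>c :: real. c + x < 0 \<and> 0 < c + y" if "x < y" for x y
    using that by (intro exI[of _ "- (x + y) / 2"]) (auto simp: field_simps)
  obtain X where X: "X \<in> GS" "Ls (G \<oplus> X) < Ls (H \<oplus> X) \<or> Rs (G \<oplus> X) < Rs (H \<oplus> X)"
    using assms(3) by (auto simp: game_ge_def not_le)
  have *: "Ls (K \<oplus> (number c \<oplus> X)) = c + Ls (K \<oplus> X)" "Rs (K \<oplus> (number c \<oplus> X)) = c + Rs (K \<oplus> X)"
    "number c \<oplus> X \<in> GS" if "scoring_game K" for K c
    using that X(1) by (simp_all add: stops_gsum_number GS_scoring_game gsum_GS number_GS)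
  have "(\<exists>T \<in> GS. Ls (G \<oplus> T) < 0 \<and> 0 < Ls (H \<oplus> T)) \<or> (\<exists>T \<in> GS. Rs (G \<oplus> T) < 0 \<and> 0 < Rs (H \<oplus> T))"
    using X(2)
  proof
    assume "Ls (G \<oplus> X) < Ls (H \<oplus> X)"
    then obtain c where "c + Ls (G \<oplus> X) < 0" "0 < c + Ls (H \<oplus> X)" using shift by blast
    then show ?thesis
      using *(1,3)[OF assms(1), of c] *(1)[OF assms(2), of c]
      by (intro disjI1 bexI[of _ "number c \<oplus> X"]) simp_all
  next
    assume "Rs (G \<oplus> X) < Rs (H \<oplus> X)"
    then obtain c where "c + Rs (G \<oplus> X) < 0" "0 < c + Rs (H \<oplus> X)" using shift by blast
    then show ?thesis
      using *(2,3)[OF assms(1), of c] *(2)[OF assms(2), of c]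
      by (intro disjI2 bexI[of _ "number c \<oplus> X"]) simp_all
  qed
  then show "\<exists>T \<in> GS. Ls (G \<oplus> T) < 0 \<and> 0 < Ls (H \<oplus> T)"
    "\<exists>T \<in> GS. Rs (G \<oplus> T) < 0 \<and> 0 < Rs (H \<oplus> T)"
    using assms(1,2) Ls_separation_of_Rs_separation Rs_separation_of_Ls_separation by meson+
qed

text \<open>The numbers \<open>- M\<close> and \<open>M\<close> among the options of the context \<open>T\<close> keep both of its sides
  non-atomic, so that \<open>T\<close> is guaranteed even if \<open>G\<close> has no Left or \<open>H\<close> no Right option.\<close>

lemma linked:
  assumes "scoring_game G" "scoring_game H"
    and G: "\<And>A. A |\<in>| left_opts G \<Longrightarrow> \<not> A \<succeq> H"
    and H: "\<And>B. B |\<in>| right_opts H \<Longrightarrow> \<not> G \<succeq> B"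
  shows "\<exists>T \<in> GS. Ls (G \<oplus> T) < 0 \<and> 0 < Rs (H \<oplus> T)"
proof -
  have "\<forall>A. \<exists>X. A |\<in>| left_opts G \<longrightarrow> X \<in> GS \<and> Ls (A \<oplus> X) < 0 \<and> 0 < Ls (H \<oplus> X)"
    using separation(1) assms scoring_game_left_opts by meson
  then obtain X where X: "\<And>A. A |\<in>| left_opts G \<Longrightarrow>
      X A \<in> GS \<and> Ls (A \<oplus> X A) < 0 \<and> 0 < Ls (H \<oplus> X A)"
    by metis
  have "\<forall>B. \<exists>Y. B |\<in>| right_opts H \<longrightarrow> Y \<in> GS \<and> Rs (G \<oplus> Y) < 0 \<and> 0 < Rs (B \<oplus> Y)"
    using separation(2) assms scoring_game_right_opts by meson
  then obtain Y where Y: "\<And>B. B |\<in>| right_opts H \<Longrightarrow>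
      Y B \<in> GS \<and> Rs (G \<oplus> Y B) < 0 \<and> 0 < Rs (B \<oplus> Y B)"
    by metis
  obtain M where M: "\<forall>s \<in> atoms G \<union> atoms H. - M < s \<and> s < M"
    using atoms_bound by blast
  define T where "T = Game (Opts (finsert (number (- M)) (Y |`| right_opts H)))
    (Opts (finsert (number M) (X |`| left_opts G)))"
  have T: "T \<in> GS"
    unfolding T_def using X Y number_GS by (intro GS_Opts) auto
  \<comment> \<open>Every Left move fails: a move to \<open>A\<close> is answered by Right's move to
    \<open>X A\<close>, a move to \<open>Y B\<close> leaves a negative Right stop, and
    \<open>number (- M)\<close> is too low.\<close>
  have "Ls (G \<oplus> T) < 0"
    using assms(1) GS_scoring_game[OF T]
  proof (cases rule: Ls_gsum_cases)
    case (left A)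
    then have "Rs (A \<oplus> T) \<le> Ls (A \<oplus> X A)"
      by (intro Rs_gsum_le) (simp add: T_def)
    with left X show ?thesis by fastforce
  next
    case (right B)
    then show ?thesis
      using Y stops_gsum_number_neg(2)[OF assms(1), of M] M by (auto simp: T_def)
  qed (simp add: T_def)
  moreover have "0 < Rs (H \<oplus> T)"
    using assms(2) GS_scoring_game[OF T]
  proof (cases rule: Rs_gsum_cases)
    case (left B)
    then have "Rs (B \<oplus> Y B) \<le> Ls (B \<oplus> T)"
      by (intro Ls_gsum_ge) (simp add: T_def)
    with left Y show ?thesis by fastforce
  next
    case (right A)
    then show ?thesis
      using X stops_gsum_number_pos(1)[OF assms(2), of M] M by (auto simp: T_def)
  qed (simp add: T_def)
  ultimately show ?thesis using T by blast
qed

text \<open>Without an answer, \<open>linked\<close> applied to \<open>G\<close> and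
  \<open>A\<close> yields a context in which moving first to \<open>A\<close> wins for Left in
  \<open>H\<close>, while Left loses in \<open>G\<close>, against
  \<open>G \<succeq> H\<close>.\<close>

lemma game_ge_left_option:
  assumes "scoring_game G" "scoring_game H" "G \<succeq> H" "A |\<in>| left_opts H"
  shows "(\<exists>C. C |\<in>| left_opts G \<and> C \<succeq> A) \<or> (\<exists>B. B |\<in>| right_opts A \<and> G \<succeq> B)"
proof (rule ccontr)
  assume "\<not> ?thesis"
  then obtain T where T: "T \<in> GS" "Ls (G \<oplus> T) < 0" "0 < Rs (A \<oplus> T)"
    using linked[OF assms(1) scoring_game_left_opts[OF assms(2,4)]] by blast
  moreover have "Rs (A \<oplus> T) \<le> Ls (H \<oplus> T)" "Ls (H \<oplus> T) \<le> Ls (G \<oplus> T)"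
    using assms(3,4) T(1) by (auto simp: game_ge_def intro: Ls_gsum_ge)
  ultimately show False by linarith
qed

text \<open>The mirror image of \<open>game_ge_left_option\<close>; conjugation reverses the
  order.\<close>

lemma game_ge_right_option:
  assumes "scoring_game G" "scoring_game H" "G \<succeq> H" "A |\<in>| right_opts G"
  shows "(\<exists>C. C |\<in>| right_opts H \<and> A \<succeq> C) \<or> (\<exists>B. B |\<in>| left_opts A \<and> B \<succeq> H)"
proof -
  have A: "scoring_game A"
    using assms(1,4) by (rule scoring_game_right_opts)
  have "conj_game H \<succeq> conj_game G" "conj_game A |\<in>| left_opts (conj_game G)"
    using assms by (simp_all add: conj_game_ge_conj_game)
  from game_ge_left_option[OF _ _ this] assms(1,2)
  consider C where "C |\<in>| right_opts H" "conj_game C \<succeq> conj_game A"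
    | B where "B |\<in>| left_opts A" "conj_game H \<succeq> conj_game B"
    by auto
  then show ?thesis
  proof cases
    case (1 C)
    then have "scoring_game C"
      using assms(2) scoring_game_right_opts by blast
    with 1 A show ?thesis
      using conj_game_ge_conj_game by blast
  next
    case (2 B)
    then have "scoring_game B"
      using A scoring_game_left_opts by blast
    with 2 assms(2) show ?thesis
      using conj_game_ge_conj_game by blast
  qed
qed

section \<open>Waiting moves as worst-case summands\<close>

lemma right_wait [simp]: "right (wait n) = Atom 0"
  by (cases n) auto

lemma neg_wait_GS: "neg_wait n \<in> GS"
  by (simp add: wait_GS)

text \<open>\<open>neg_wait n\<close> shifted by \<open>x\<close> is the worst replacement for
  \<open>X\<close> from Left's point of view: Left has no move in it, its score is as low as any in
  \<open>X\<close>, and \<open>size X \<le> n\<close> gives Right enough passes to match all moves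
  in \<open>X\<close>. Left's best move on the waiting side is copied to
  \<open>G \<oplus> X\<close>, and Right's best move there is copied back.\<close>

lemma stops_gsum_ge_neg_wait:
  assumes "G \<in> GS" "X \<in> GS" "\<And>s. s \<in> atoms X \<Longrightarrow> x \<le> s" "size X \<le> n"
  shows "x + Ls (G \<oplus> neg_wait n) \<le> Ls (G \<oplus> X) \<and> x + Rs (G \<oplus> neg_wait n) \<le> Rs (G \<oplus> X)"
  using assms
proof (induction "size G + size X" arbitrary: G X n rule: less_induct)
  case less
  note scoring = GS_scoring_game[OF less.prems(1)] GS_scoring_game[OF less.prems(2)]
    GS_scoring_game[OF neg_wait_GS, of n]
  have "x + Ls (G \<oplus> neg_wait n) \<le> Ls (G \<oplus> X)"
    using scoring(1,3)
  proof (cases rule: Ls_gsum_cases)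
    \<comment> \<open>Left is stuck in \<open>G\<close>; as \<open>G\<close> is guaranteed, its Left
      atom \<open>g\<close> is the least score that \<open>G\<close> can contribute to any
      continuation.\<close>
    case (Atom g b)
    have "Ls (G \<oplus> X) \<in> atoms (G \<oplus> X)"
      using scoring scoring_game_gsum stops_in_atoms by blast
    then obtain s t where "s \<in> atoms G" "t \<in> atoms X" "Ls (G \<oplus> X) = s + t"
      by (rule atoms_gsum)
    moreover from this have "g \<le> s" "x \<le> t"
      using Atom less.prems GS_left_Atom by auto
    ultimately show ?thesis using Atom by simp
  next
    case (left A)
    then have "x + Rs (A \<oplus> neg_wait n) \<le> Rs (A \<oplus> X)"
      using less.hyps[of A X n] less.prems GS_left_opts size_left_opts by simp
    also have "\<dots> \<le> Ls (G \<oplus> X)"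
      using left by (intro Ls_gsum_ge)
    finally show ?thesis using left by simp
  qed simp
  moreover have "x + Rs (G \<oplus> neg_wait n) \<le> Rs (G \<oplus> X)"
    using scoring(1,2)
  proof (cases rule: Rs_gsum_cases)
    case (Atom g y)
    have "Rs (G \<oplus> neg_wait n) \<in> atoms (G \<oplus> neg_wait n)"
      using scoring scoring_game_gsum stops_in_atoms by blast
    then have "Rs (G \<oplus> neg_wait n) \<in> atoms G"
      using wait_props(2)[of n] by (elim atoms_gsum) auto
    then have "Rs (G \<oplus> neg_wait n) \<le> g"
      using Atom less.prems(1) GS_right_Atom by blast
    moreover have "x \<le> y"
      using Atom less.prems(3) atoms_right_Atom by blast
    ultimately show ?thesis using Atom by simp
  next
    case (left A)
    then have "x + Ls (A \<oplus> neg_wait n) \<le> Ls (A \<oplus> X)"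
      using less.hyps[of A X n] less.prems GS_right_opts size_right_opts by simp
    moreover have "Rs (G \<oplus> neg_wait n) \<le> Ls (A \<oplus> neg_wait n)"
      using left by (intro Rs_gsum_le)
    ultimately show ?thesis using left by simp
  next
    case (right B)
    \<comment> \<open>Right's move to \<open>B\<close> is matched by one pass: the size bound makes
      \<open>n\<close> positive, and it persists for \<open>B\<close> and the predecessor of
      \<open>n\<close>.\<close>
    then have "size B < n"
      using less.prems(4) size_right_opts by fastforce
    then obtain m where m: "n = Suc m" "size B \<le> m"
      by (cases n) auto
    have "x \<le> s" if "s \<in> atoms B" for s
      using that right less.prems(3) atoms_follower followers_right by blast
    then have "x + Ls (G \<oplus> neg_wait m) \<le> Ls (G \<oplus> B)"
      using less.hyps[of G B m] less.prems right m GS_right_opts size_right_opts by simp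
    moreover have "Rs (G \<oplus> neg_wait n) \<le> Ls (G \<oplus> neg_wait m)"
      by (intro Rs_gsum_le) (simp add: m)
    ultimately show ?thesis using right by simp
  qed
  ultimately show ?case ..
qed

subsection \<open>Pass-allowed stops and the order\<close>

lemma lower_stops_le:
  assumes "scoring_game G"
  shows "lower_Ls G \<le> Ls (G \<oplus> neg_wait n)" "lower_Rs G \<le> Rs (G \<oplus> neg_wait n)"
  unfolding lower_Ls_def lower_Rs_def
  by (rule Min_le; simp add: finite_range_pass_allowed[OF assms])+

lemma lower_stops_attained:
  assumes "scoring_game G"
  shows "\<exists>n. lower_Ls G = Ls (G \<oplus> neg_wait n)" "\<exists>n. lower_Rs G = Rs (G \<oplus> neg_wait n)"
proof -
  have "lower_Ls G \<in> range (\<lambda>k. Ls (G \<oplus> neg_wait k))"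
    unfolding lower_Ls_def by (rule Min_in) (auto simp: finite_range_pass_allowed[OF assms])
  then show "\<exists>n. lower_Ls G = Ls (G \<oplus> neg_wait n)" by auto
  have "lower_Rs G \<in> range (\<lambda>k. Rs (G \<oplus> neg_wait k))"
    unfolding lower_Rs_def by (rule Min_in) (auto simp: finite_range_pass_allowed[OF assms])
  then show "\<exists>n. lower_Rs G = Rs (G \<oplus> neg_wait n)" by auto
qed

text \<open>Taking a minimising \<open>neg_wait m\<close> for \<open>X\<close> and
  \<open>x = 0\<close> in \<open>stops_gsum_ge_neg_wait\<close> shows that every sufficiently long
  waiting move does at least as well for Right, hence also attains the minimum.\<close>

lemma eventually_lower_stops:
  assumes "G \<in> GS"
  shows "\<forall>\<^sub>F n in sequentially. Ls (G \<oplus> neg_wait n) = lower_Ls G"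
    and "\<forall>\<^sub>F n in sequentially. Rs (G \<oplus> neg_wait n) = lower_Rs G"
proof -
  note G = GS_scoring_game[OF assms]
  have mono: "Ls (G \<oplus> neg_wait n) \<le> Ls (G \<oplus> neg_wait m)" "Rs (G \<oplus> neg_wait n) \<le> Rs (G \<oplus> neg_wait m)"
    if "size (neg_wait m) \<le> n" for m n
    using stops_gsum_ge_neg_wait[OF assms neg_wait_GS, of m 0 n] wait_props(2)[of m] that by auto
  obtain m where "lower_Ls G = Ls (G \<oplus> neg_wait m)"
    using lower_stops_attained(1)[OF G] by blast
  then show "\<forall>\<^sub>F n in sequentially. Ls (G \<oplus> neg_wait n) = lower_Ls G"
    using mono(1)[of m] lower_stops_le(1)[OF G]
    by (intro eventually_sequentiallyI[of "size (neg_wait m)"]) (auto intro!: antisym)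
  obtain m where "lower_Rs G = Rs (G \<oplus> neg_wait m)"
    using lower_stops_attained(2)[OF G] by blast
  then show "\<forall>\<^sub>F n in sequentially. Rs (G \<oplus> neg_wait n) = lower_Rs G"
    using mono(2)[of m] lower_stops_le(2)[OF G]
    by (intro eventually_sequentiallyI[of "size (neg_wait m)"]) (auto intro!: antisym)
qed

lemma lower_Ls_Atom:
  assumes "left G = Atom l"
  shows "lower_Ls G = l"
proof -
  have "Ls (G \<oplus> neg_wait n) = l" for n
    using assms by (intro Ls_Atom) (simp add: left_gsum_eq_Atom)
  then show ?thesis by (simp add: lower_Ls_def)
qed

lemma number_neg_wait_GS: "number l \<oplus> neg_wait n \<in> GS"
  by (intro gsum_GS number_GS neg_wait_GS)

lemma lower_Rs_number_neg_wait: "lower_Rs (number l \<oplus> neg_wait n) = l"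
proof -
  have "scoring_game (number l \<oplus> neg_wait n)"
    by (rule GS_scoring_game[OF number_neg_wait_GS])
  then have "Rs ((number l \<oplus> neg_wait n) \<oplus> neg_wait k) \<in> atoms (number l \<oplus> neg_wait n)" for k
    using stops_sum_in_atoms wait_props(2) by blast
  then have "Rs ((number l \<oplus> neg_wait n) \<oplus> neg_wait k) = l" for k
    using atoms_number_neg_wait by blast
  then show ?thesis by (simp add: lower_Rs_def)
qed

lemma lower_Rs_le_lower_Ls:
  assumes "scoring_game G" "A |\<in>| left_opts G"
  shows "lower_Rs A \<le> lower_Ls G"
proof -
  obtain n where n: "lower_Ls G = Ls (G \<oplus> neg_wait n)"
    using lower_stops_attained(1)[OF assms(1)] by blast
  have "lower_Rs A \<le> Rs (A \<oplus> neg_wait n)"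
    using assms scoring_game_left_opts by (blast intro: lower_stops_le)
  also have "\<dots> \<le> Ls (G \<oplus> neg_wait n)"
    using assms(2) by (rule Ls_gsum_ge)
  finally show ?thesis using n by simp
qed

text \<open>The minimum over \<open>k\<close> commutes with the maximum over the Left options because each stop
  is constant for large \<open>k\<close>.\<close>

lemma lower_Ls_option:
  assumes "G \<in> GS" "left_opts G \<noteq> {||}"
  shows "\<exists>A. A |\<in>| left_opts G \<and> lower_Ls G = lower_Rs A"
proof -
  have "\<forall>\<^sub>F n in sequentially. \<forall>A \<in> fset (left_opts G). Rs (A \<oplus> neg_wait n) = lower_Rs A"
    using eventually_lower_stops(2) GS_left_opts[OF assms(1)]
    by (intro eventually_ball_finite) auto
  with eventually_lower_stops(1)[OF assms(1)]
  have "\<forall>\<^sub>F n in sequentially. Ls (G \<oplus> neg_wait n) = lower_Ls G \<and>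
      (\<forall>A \<in> fset (left_opts G). Rs (A \<oplus> neg_wait n) = lower_Rs A)"
    by (rule eventually_conj)
  then obtain n where n: "Ls (G \<oplus> neg_wait n) = lower_Ls G"
    "\<And>A. A |\<in>| left_opts G \<Longrightarrow> Rs (A \<oplus> neg_wait n) = lower_Rs A"
    using eventually_happens'[OF sequentially_bot] by blast
  from GS_scoring_game[OF assms(1)] GS_scoring_game[OF neg_wait_GS, of n]
  show ?thesis
  proof (cases rule: Ls_gsum_cases)
    case (left A)
    then show ?thesis using n by auto
  qed (use assms(2) in auto)
qed

lemma lower_Ls_mono:
  assumes "scoring_game G" "G \<succeq> H" "scoring_game H"
  shows "lower_Ls H \<le> lower_Ls G"
proof -
  obtain n where "lower_Ls G = Ls (G \<oplus> neg_wait n)"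
    using lower_stops_attained(1)[OF assms(1)] by blast
  also have "\<dots> \<ge> Ls (H \<oplus> neg_wait n)"
    using assms(2) neg_wait_GS by (auto simp: game_ge_def)
  finally show ?thesis
    using lower_stops_le(1)[OF assms(3), of n] by simp
qed

lemma lower_stops_conj_game:
  assumes "scoring_game G"
  shows "lower_Ls (conj_game G) = - upper_Rs G" "lower_Rs (conj_game G) = - upper_Ls G"
proof -
  have fin: "finite (range (\<lambda>n. Rs (G \<oplus> wait n)))" "finite (range (\<lambda>n. Ls (G \<oplus> wait n)))"
    using finite_range_pass_allowed[OF assms] by auto
  have MinMax: "Min (range (\<lambda>n. - f n)) = - Max (range f)"
    if "finite (range f)" for f :: "nat \<Rightarrow> real"
  proof (rule Min_eqI)
    show "finite (range (\<lambda>n. - f n))"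
      using finite_imageI[OF that, of uminus] by (simp add: image_image)
    show "- Max (range f) \<le> y" if "y \<in> range (\<lambda>n. - f n)" for y
      using that \<open>finite (range f)\<close> by auto
    have "Max (range f) \<in> range f"
      using that by (intro Max_in) auto
    then obtain n where "Max (range f) = f n" by blast
    then show "- Max (range f) \<in> range (\<lambda>n. - f n)" by simp
  qed
  have "conj_game G \<oplus> neg_wait n = conj_game (G \<oplus> wait n)" for n
    by (simp add: conj_game_gsum)
  then have "Ls (conj_game G \<oplus> neg_wait n) = - Rs (G \<oplus> wait n)"
    "Rs (conj_game G \<oplus> neg_wait n) = - Ls (G \<oplus> wait n)" for n
    using assms by (simp_all add: Ls_conj_game Rs_conj_game scoring_game_gsum GS_scoring_game wait_GS)
  then show "lower_Ls (conj_game G) = - upper_Rs G" "lower_Rs (conj_game G) = - upper_Ls G"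
    by (simp_all add: lower_Ls_def lower_Rs_def upper_Rs_def upper_Ls_def MinMax fin)
qed

lemma upper_Rs_Atom:
  assumes "scoring_game G" "right G = Atom r"
  shows "upper_Rs G = r"
  using lower_stops_conj_game(1)[OF assms(1)] lower_Ls_Atom[of "conj_game G" "- r"] assms(2) by simp

lemma upper_Rs_mono:
  assumes "scoring_game G" "G \<succeq> H" "scoring_game H"
  shows "upper_Rs H \<le> upper_Rs G"
  using lower_Ls_mono[of "conj_game H" "conj_game G"] assms
  by (simp add: conj_game_ge_conj_game lower_stops_conj_game)

text \<open>Since \<open>X\<close> is guaranteed, none of its atoms is below \<open>x\<close>, so a
  waiting move of order \<open>size X\<close> is a valid replacement for it.\<close>

lemma Ls_gsum_left_Atom_ge:
  assumes "G \<in> GS" "X \<in> GS" "left X = Atom x"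
  shows "lower_Ls G + x \<le> Ls (G \<oplus> X)"
  using stops_gsum_ge_neg_wait[of G X x "size X"] assms GS_left_Atom
    lower_stops_le(1)[OF GS_scoring_game, of G "size X"] by fastforce

lemma Rs_gsum_right_Atom_le:
  assumes "G \<in> GS" "X \<in> GS" "right X = Atom x"
  shows "Rs (G \<oplus> X) \<le> upper_Rs G + x"
proof -
  have "lower_Ls (conj_game G) + - x \<le> Ls (conj_game (G \<oplus> X))"
    unfolding conj_game_gsum using assms by (intro Ls_gsum_left_Atom_ge) auto
  then show ?thesis
    using assms by (simp add: lower_stops_conj_game Ls_conj_game GS_scoring_game gsum_GS)
qed

text \<open>Induction on the context \<open>X\<close> alone. Moves in \<open>G\<close> or
  \<open>H\<close> are handled by the assumed answers within the same context, moves in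
  \<open>X\<close> by the induction hypothesis. The two conditions on atoms cover positions where
  the component and \<open>X\<close> are both stuck.\<close>

theorem game_geI:
  assumes "G \<in> GS" "H \<in> GS"
    and left: "\<And>A. A |\<in>| left_opts H \<Longrightarrow>
      (\<exists>C. C |\<in>| left_opts G \<and> C \<succeq> A) \<or> (\<exists>B. B |\<in>| right_opts A \<and> G \<succeq> B)"
    and right: "\<And>A. A |\<in>| right_opts G \<Longrightarrow>
      (\<exists>C. C |\<in>| right_opts H \<and> A \<succeq> C) \<or> (\<exists>B. B |\<in>| left_opts A \<and> B \<succeq> H)"
    and left_Atom: "\<And>h. left H = Atom h \<Longrightarrow> h \<le> lower_Ls G"
    and right_Atom: "\<And>g. right G = Atom g \<Longrightarrow> upper_Rs H \<le> g"
  shows "G \<succeq> H"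
proof -
  have "Ls (H \<oplus> X) \<le> Ls (G \<oplus> X) \<and> Rs (H \<oplus> X) \<le> Rs (G \<oplus> X)" if "X \<in> GS" for X
    using that
  proof (induction "size X" arbitrary: X rule: less_induct)
    case less
    note scoring = assms(1,2)[THEN GS_scoring_game] GS_scoring_game[OF less.prems]
    have ge: "Ls (L \<oplus> X) \<le> Ls (K \<oplus> X)" "Rs (L \<oplus> X) \<le> Rs (K \<oplus> X)" if "K \<succeq> L" for K L
      using that less.prems by (auto simp: game_ge_def)
    have "Ls (H \<oplus> X) \<le> Ls (G \<oplus> X)"
      using scoring(2,3)
    proof (cases rule: Ls_gsum_cases)
      case (Atom h x)
      then show ?thesis
        using left_Atom[of h] Ls_gsum_left_Atom_ge[OF assms(1) less.prems, of x] by simp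
    next
      case (left A)
      from assms(3)[OF left(1)] show ?thesis
      proof (elim disjE exE conjE)
        fix C assume "C |\<in>| left_opts G" "C \<succeq> A"
        from order_trans[OF ge(2)[OF this(2)] Ls_gsum_ge(1)[OF this(1)]] left
        show ?thesis by simp
      next
        \<comment> \<open>Right may reverse Left's move to \<open>A\<close> by going to
          \<open>B\<close>, after which Left is no better off than when moving in
          \<open>G \<oplus> X\<close>.\<close>
        fix B assume "B |\<in>| right_opts A" "G \<succeq> B"
        from order_trans[OF Rs_gsum_le(1)[OF this(1)] ge(1)[OF this(2)]] left
        show ?thesis by simp
      qed
    next
      case (right B)
      then have "Rs (H \<oplus> B) \<le> Rs (G \<oplus> B)"
        using less size_left_opts GS_left_opts by blast
      also have "\<dots> \<le> Ls (G \<oplus> X)"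
        using right by (intro Ls_gsum_ge)
      finally show ?thesis using right by simp
    qed
    moreover have "Rs (H \<oplus> X) \<le> Rs (G \<oplus> X)"
      using scoring(1,3)
    proof (cases rule: Rs_gsum_cases)
      case (Atom g x)
      then show ?thesis
        using right_Atom[of g] Rs_gsum_right_Atom_le[OF assms(2) less.prems, of x] by simp
    next
      case (left A)
      from assms(4)[OF left(1)] show ?thesis
      proof (elim disjE exE conjE)
        fix C assume "C |\<in>| right_opts H" "A \<succeq> C"
        from order_trans[OF Rs_gsum_le(1)[OF this(1)] ge(1)[OF this(2)]] left
        show ?thesis by simp
      next
        fix B assume "B |\<in>| left_opts A" "B \<succeq> H"
        from order_trans[OF ge(2)[OF this(2)] Ls_gsum_ge(1)[OF this(1)]] left
        show ?thesis by simp
      qed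
    next
      case (right B)
      then have "Ls (H \<oplus> B) \<le> Ls (G \<oplus> B)"
        using less size_right_opts GS_right_opts by blast
      moreover have "Rs (H \<oplus> X) \<le> Ls (H \<oplus> B)"
        using right by (intro Rs_gsum_le)
      ultimately show ?thesis using right by simp
    qed
    ultimately show ?case ..
  qed
  then show ?thesis by (simp add: game_ge_def)
qed

text \<open>The form suited to Left reductions: equal Right options answer each other by
  reflexivity, and a common Right atom is the upper stop of both games.\<close>

lemma game_ge_same_rightI:
  assumes "G \<in> GS" "H \<in> GS" "right G = right H"
    and "\<And>A. A |\<in>| left_opts H \<Longrightarrow>
      (\<exists>C. C |\<in>| left_opts G \<and> C \<succeq> A) \<or> (\<exists>B. B |\<in>| right_opts A \<and> G \<succeq> B)"
    and "\<And>h. left H = Atom h \<Longrightarrow> h \<le> lower_Ls G"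
  shows "G \<succeq> H"
proof (rule game_geI)
  show "upper_Rs H \<le> g" if "right G = Atom g" for g
    using that assms(2,3) upper_Rs_Atom[of H g] by (simp add: GS_scoring_game)
qed (use assms game_ge_refl in auto)

text \<open>Changing the Left side of \<open>K\<close> preserves \<open>K \<succeq> B\<close> as long as the new Left side still
  answers \<open>B\<close>: the conditions on the Right options only involve \<open>right K\<close>.\<close>

lemma game_ge_change_left:
  assumes "K \<in> GS" "K' \<in> GS" "B \<in> GS" "K \<succeq> B" "right K' = right K"
    and "left_opts B |\<subseteq>| left_opts K'"
    and "\<And>h. left B = Atom h \<Longrightarrow> h \<le> lower_Ls K'"
  shows "K' \<succeq> B"
proof (rule game_geI)
  show "(\<exists>C. C |\<in>| right_opts B \<and> A \<succeq> C) \<or> (\<exists>C. C |\<in>| left_opts A \<and> C \<succeq> B)"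
    if "A |\<in>| right_opts K'" for A
    using that game_ge_right_option[of K B A] assms GS_scoring_game by auto
  show "upper_Rs B \<le> g" if "right K' = Atom g" for g
    using that upper_Rs_mono[of K B] upper_Rs_Atom[of K g] assms GS_scoring_game by auto
qed (use assms game_ge_refl in auto)

text \<open>No new atoms enter, so a Right atom of \<open>K\<close> remains an upper bound.\<close>

lemma GS_change_left:
  assumes "K \<in> GS" "F \<noteq> {||}" "\<And>A. A |\<in>| F \<Longrightarrow> A \<in> GS \<and> atoms A \<subseteq> atoms K"
  shows "Game (Opts F) (right K) \<in> GS"
proof (rule GS_GameI)
  show "right K \<noteq> Opts {||}" using assms(1) GS_scoring_game scoring_game_sides by blast
  show "A \<in> GS" if "A |\<in>| right_opts K" for A using that assms(1) GS_right_opts by blast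
  fix r s assume r: "right K = Atom r" and "s \<in> atoms (Game (Opts F) (right K))"
  then have "s \<in> atoms K"
    using assms(3) atoms_right_Atom[OF r] by (subst (asm) atoms_unfold) auto
  then show "s \<le> r" using assms(1) r GS_right_Atom by blast
qed (use assms in auto)

subsection \<open>Reductions\<close>

lemma left_reversibleD:
  assumes "K \<in> GS" "left_reversible K A B"
  shows "A |\<in>| left_opts K" "B |\<in>| right_opts A" "K \<succeq> B" "B \<in> GS" "B \<in> followers K"
  using assms GS_left_opts GS_right_opts followers.right[OF followers_left]
  unfolding left_reversible_def by blast+

text \<open>New Left options are followers of \<open>K\<close> or the waiting option, whose only
  atom \<open>l\<close> occurs in \<open>K\<close>. For \<open>atomic_empty\<close> membership is a
  premise.\<close>

lemma left_reduction_GS: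
  assumes "K \<in> GS" "left_reduction K K'"
  shows "K' \<in> GS"
proof -
  have follower: "A \<in> GS \<and> atoms A \<subseteq> atoms K" if "A \<in> followers K" for A
    using that assms(1) GS_follower atoms_follower by blast
  have opt: "A \<in> GS \<and> atoms A \<subseteq> atoms K" if "A |\<in>| left_opts K" for A
    using that follower followers_left by blast
  from assms(2) show ?thesis
  proof cases
    case (dominated A B)
    then have "B |\<in>| left_opts K |-| {|A|}" by auto
    then show ?thesis
      unfolding dominated(1) using opt assms(1) by (intro GS_change_left) auto
  next
    case (reverse A B F)
    note B = left_reversibleD[OF assms(1) reverse(2)]
    have "C \<in> followers K" if "C |\<in>| F" for C
      using that reverse(3) B(5) followers.left by fastforce
    then show ?thesis
      unfolding reverse(1) using opt follower reverse(4) assms(1) by (intro GS_change_left) auto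
  next
    case (atomic_delete A B l C)
    then have "C |\<in>| left_opts K |-| {|A|}" by auto
    then show ?thesis
      unfolding atomic_delete(1) using opt assms(1) by (intro GS_change_left) auto
  next
    case (atomic_replace A B l n)
    note B = left_reversibleD[OF assms(1)] atomic_replace(2)[unfolded left_atomic_reversible_def]
    then have "l \<in> atoms K"
      using atoms_follower atoms_left_Atom by blast
    then have "atoms (number l \<oplus> neg_wait (n + 1)) \<subseteq> atoms K"
      using atoms_number_neg_wait by blast
    moreover have "number l \<oplus> neg_wait (n + 1) \<in> GS"
      by (rule number_neg_wait_GS)
    ultimately show ?thesis
      unfolding atomic_replace(1) using opt assms(1) by (intro GS_change_left) auto
  qed auto
qed

text \<open>Except for domination, the crux is that \<open>K' \<succeq> B\<close> survives the
  change. Then \<open>K'\<close> answers the lost option \<open>A\<close> through its Right option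
  \<open>B\<close>. Conversely \<open>K\<close> answers whatever was added, using
  \<open>K \<succeq> B\<close> or the choice of \<open>n\<close>.\<close>

lemma left_reduction_equiv:
  assumes K: "K \<in> GS" and "left_reduction K K'"
  shows "K' \<sim> K"
proof -
  have K': "K' \<in> GS" using assms by (rule left_reduction_GS)
  have opts: "left K \<noteq> Atom h" if "A |\<in>| left_opts K" for A h
    using that by auto
  have lower_Ls_ge: "l \<le> lower_Ls K" if "left_atomic_reversible K A B l" for A B l
    using that lower_Ls_mono[of K B] lower_Ls_Atom[of B l] left_reversibleD[OF K]
    by (auto simp: left_atomic_reversible_def K GS_scoring_game)
  have rev_ge: "K' \<succeq> B"
    if "left_reversible K A B" "right K' = right K" "left_opts B |\<subseteq>| left_opts K'"
      "\<And>h. left B = Atom h \<Longrightarrow> h \<le> lower_Ls K'" for A B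
    by (rule game_ge_change_left[OF K K' _ _ that(2-4)])
      (use left_reversibleD[OF K that(1)] in auto)
  have "K \<succeq> K' \<and> K' \<succeq> K"
    using assms(2)
  proof cases
    case (dominated A B)
    have "K \<succeq> K'"
      by (rule game_ge_same_rightI[OF K K']) (use dominated game_ge_refl in auto)
    moreover have "K' \<succeq> K"
    proof (rule game_ge_same_rightI[OF K' K])
      show "(\<exists>C'. C' |\<in>| left_opts K' \<and> C' \<succeq> C) \<or> (\<exists>D. D |\<in>| right_opts C \<and> K' \<succeq> D)"
        if "C |\<in>| left_opts K" for C
        using that dominated game_ge_refl by (cases "C = A") auto
    qed (use dominated(1) opts[OF dominated(2)] in auto)
    ultimately show ?thesis ..
  next
    case (reverse A B F)
    note B = left_reversibleD[OF K reverse(2)]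
    have "K \<succeq> K'"
    proof (rule game_ge_same_rightI[OF K K'])
      show "(\<exists>C'. C' |\<in>| left_opts K \<and> C' \<succeq> C) \<or> (\<exists>D. D |\<in>| right_opts C \<and> K \<succeq> D)"
        if "C |\<in>| left_opts K'" for C
      proof (cases "C |\<in>| F")
        case True
        then show ?thesis
          using game_ge_left_option[of K B C] reverse(3) B K GS_scoring_game by auto
      qed (use that reverse game_ge_refl in auto)
    qed (use reverse in auto)
    moreover have "K' \<succeq> B"
      using reverse(2) by (rule rev_ge) (use reverse in auto)
    then have "K' \<succeq> K"
    proof (intro game_ge_same_rightI[OF K' K])
      show "(\<exists>C'. C' |\<in>| left_opts K' \<and> C' \<succeq> C) \<or> (\<exists>D. D |\<in>| right_opts C \<and> K' \<succeq> D)"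
        if "C |\<in>| left_opts K" for C
        using that reverse(1) B(2) \<open>K' \<succeq> B\<close> game_ge_refl by (cases "C = A") auto
    qed (use reverse(1) opts[OF B(1)] in auto)
    ultimately show ?thesis ..
  next
    case (atomic_delete A B l C)
    then have rev: "left_reversible K A B" and l: "left B = Atom l"
      by (auto simp: left_atomic_reversible_def)
    note B = left_reversibleD[OF K rev]
    have C: "C |\<in>| left_opts K'" using atomic_delete by auto
    have "K \<succeq> K'"
      by (rule game_ge_same_rightI[OF K K']) (use atomic_delete game_ge_refl in auto)
    \<comment> \<open>The surviving option \<open>C\<close> attains \<open>lower_Ls K\<close>, so
      deleting \<open>A\<close> does not push the pass-allowed stop below \<open>l\<close>.\<close>
    moreover have "l \<le> lower_Ls K'"
      using lower_Ls_ge[OF atomic_delete(2)] atomic_delete(5) lower_Rs_le_lower_Ls[OF GS_scoring_game[OF K'] C]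
      by auto
    then have "K' \<succeq> B"
      by (intro rev_ge[OF rev]) (use l atomic_delete(1) in auto)
    then have "K' \<succeq> K"
    proof (intro game_ge_same_rightI[OF K' K])
      show "(\<exists>C'. C' |\<in>| left_opts K' \<and> C' \<succeq> C) \<or> (\<exists>D. D |\<in>| right_opts C \<and> K' \<succeq> D)"
        if "C |\<in>| left_opts K" for C
        using that atomic_delete(1) B(2) \<open>K' \<succeq> B\<close> game_ge_refl by (cases "C = A") auto
    qed (use atomic_delete(1) opts[OF B(1)] in auto)
    ultimately show ?thesis ..
  next
    case (atomic_replace A B l n)
    then have rev: "left_reversible K A B" and l: "left B = Atom l"
      by (auto simp: left_atomic_reversible_def)
    note B = left_reversibleD[OF K rev]
    define W where "W = number l \<oplus> neg_wait (n + 1)"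
    have W: "W |\<in>| left_opts K'" by (simp add: atomic_replace(1) W_def)
    \<comment> \<open>The new option \<open>W\<close> is itself reversible in \<open>K\<close>: its
      only Right option is one waiting move shorter, and \<open>n\<close> is chosen so that
      \<open>K\<close> lies above that.\<close>
    have K_W: "number l \<oplus> neg_wait n |\<in>| right_opts W"
      using number_neg_wait(3)[of l n] by (simp add: W_def)
    have "K \<succeq> K'"
    proof (rule game_ge_same_rightI[OF K K'])
      show "(\<exists>C'. C' |\<in>| left_opts K \<and> C' \<succeq> C) \<or> (\<exists>D. D |\<in>| right_opts C \<and> K \<succeq> D)"
        if "C |\<in>| left_opts K'" for C
      proof (cases "C = W")
        case True
        with K_W atomic_replace(5) show ?thesis by blast
      qed (use that atomic_replace(1) W_def game_ge_refl in auto)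
    qed (use atomic_replace(1) in auto)
    \<comment> \<open>Here \<open>W\<close> supplies the bound, since all of its atoms equal
      \<open>l\<close>.\<close>
    moreover have "l \<le> lower_Ls K'"
      using lower_Rs_le_lower_Ls[OF GS_scoring_game[OF K'] W] lower_Rs_number_neg_wait[of l "n + 1"]
      by (auto simp: W_def)
    then have "K' \<succeq> B"
      by (intro rev_ge[OF rev]) (use l atomic_replace(1) in auto)
    then have "K' \<succeq> K"
    proof (intro game_ge_same_rightI[OF K' K])
      show "(\<exists>C'. C' |\<in>| left_opts K' \<and> C' \<succeq> C) \<or> (\<exists>D. D |\<in>| right_opts C \<and> K' \<succeq> D)"
        if "C |\<in>| left_opts K" for C
        using that atomic_replace(1) B(2) \<open>K' \<succeq> B\<close> game_ge_refl by (cases "C = A") auto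
    qed (use atomic_replace(1) opts[OF B(1)] in auto)
    ultimately show ?thesis ..
  next
    case (atomic_empty A B l)
    then have rev: "left_reversible K A B" and l: "left B = Atom l"
      by (auto simp: left_atomic_reversible_def)
    note B = left_reversibleD[OF K rev]
    have "K \<succeq> K'"
      by (rule game_ge_same_rightI[OF K K'])
        (use atomic_empty(1) lower_Ls_ge[OF atomic_empty(2)] in auto)
    moreover have "lower_Ls K' = l"
      by (rule lower_Ls_Atom) (simp add: atomic_empty(1))
    then have "K' \<succeq> B"
      by (intro rev_ge[OF rev]) (use l atomic_empty(1) in auto)
    then have "K' \<succeq> K"
      by (intro game_ge_same_rightI[OF K' K]) (use atomic_empty(1,4) B opts[OF B(1)] in auto)
    ultimately show ?thesis ..
  qed
  then show ?thesis by (simp add: game_equiv_def)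
qed


section \<open>Transfer to Right reductions, and irreducible games\<close>

lemma right_reversible_conj_game:
  assumes "K \<in> GS" "left_reversible (conj_game K) A B"
  shows "right_reversible K (conj_game A) (conj_game B)"
proof -
  have "B \<in> GS"
    using left_reversibleD(4)[OF _ assms(2)] assms(1) by simp
  then have "conj_game B \<succeq> K"
    using assms conj_game_ge_conj_game[of K "conj_game B"]
    by (simp add: left_reversible_def GS_scoring_game)
  then show ?thesis
    using assms(2) by (auto simp: left_reversible_def right_reversible_def)
qed

text \<open>Allows all later arguments to speak of Left sides only: irreducibility of
  \<open>K\<close> on the Right becomes irreducibility of \<open>conj_game K\<close> on the
  Left.\<close>

lemma right_reduction_conj_game:
  assumes "K \<in> GS" "left_reduction (conj_game K) K'"
  shows "right_reduction K (conj_game K')"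
proof -
  have image: "conj_game |`| (conj_game |`| R) = R" for R
    by (simp add: fset.map_comp comp_def)
  have minus: "conj_game |`| (conj_game |`| R |-| {|A|}) = R |-| {|conj_game A|}" for R A
    by (force intro: fset_eqI)
  have opt: "conj_game C |\<in>| right_opts K" "scoring_game C" if "C |\<in>| left_opts (conj_game K)" for C
    using that assms(1) scoring_game_left_opts[OF _ that] by (auto simp: GS_scoring_game)
  have stops: "upper_Rs K = upper_Ls (conj_game C) \<longleftrightarrow> lower_Ls (conj_game K) = lower_Rs C"
    "lower_Rs C = - upper_Ls (conj_game C)"
    if "C |\<in>| left_opts (conj_game K)" for C
    using opt(2)[OF that] lower_stops_conj_game(2)[of "conj_game C"] lower_stops_conj_game(1)[of K] assms(1)
    by (auto simp: GS_scoring_game)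
  have atomic: "right_atomic_reversible K (conj_game A) (conj_game B) (- l)" "A |\<in>| left_opts (conj_game K)"
    if "left_atomic_reversible (conj_game K) A B l" for A B l
    using that right_reversible_conj_game[OF assms(1)]
    by (auto simp: left_atomic_reversible_def right_atomic_reversible_def left_reversible_def)
  from assms(2) show ?thesis
  proof cases
    case (dominated A B)
    then have "conj_game A \<succeq> conj_game B"
      using opt(2) by (simp add: conj_game_ge_conj_game)
    then have "right_reduction K (Game (left K) (Opts (right_opts K |-| {|conj_game A|})))"
      using dominated opt(1) by (intro right_reduction.dominated[of _ _ "conj_game B"]) auto
    then show ?thesis by (simp add: dominated(1) minus)
  next
    case (reverse A B F)
    have "right (conj_game B) = Opts (conj_game |`| F)"
      by (simp add: reverse(3))
    then have "right_reduction K
        (Game (left K) (Opts (right_opts K |-| {|conj_game A|} |\<union>| conj_game |`| F)))"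
      using right_reversible_conj_game[OF assms(1) reverse(2)] reverse(4)
      by (intro right_reduction.reverse) auto
    then show ?thesis by (simp add: reverse(1) minus fimage_funion)
  next
    case (atomic_delete A B l C)
    have "right_reduction K (Game (left K) (Opts (right_opts K |-| {|conj_game A|})))"
      by (rule right_reduction.atomic_delete[OF atomic(1)[OF atomic_delete(2)], of "conj_game C"])
        (use atomic_delete opt stops in auto)
    then show ?thesis by (simp add: atomic_delete(1) minus)
  next
    case (atomic_replace A B l n)
    note A = atomic(2)[OF atomic_replace(2)]
    \<comment> \<open>The comparisons defining the least \<open>n\<close> correspond for each
      \<open>m\<close>, so both reductions use the same \<open>n\<close>.\<close>
    have ge: "number (- l) \<oplus> wait m \<succeq> K \<longleftrightarrow> conj_game K \<succeq> number l \<oplus> neg_wait m" for m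
      using conj_game_ge_conj_game[of K "number (- l) \<oplus> wait m"] assms(1)
      by (simp add: conj_game_gsum GS_scoring_game gsum_GS number_GS wait_GS)
    have "right_reduction K (Game (left K)
        (Opts (finsert (number (- l) \<oplus> wait (n + 1)) (right_opts K |-| {|conj_game A|}))))"
    proof (rule right_reduction.atomic_replace[OF atomic(1)[OF atomic_replace(2)]])
      show "upper_Rs K = upper_Ls (conj_game A)"
        using stops(1)[OF A] atomic_replace(3) by simp
      show "upper_Ls (conj_game A) < upper_Ls C" if "C |\<in>| right_opts K" "C \<noteq> conj_game A" for C
      proof -
        have C: "conj_game C |\<in>| left_opts (conj_game K)" "conj_game C \<noteq> A"
          using that by auto
        from atomic_replace(4)[OF C] show ?thesis
          using stops(2)[OF A] stops(2)[OF C(1)] by simp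
      qed
    qed (use atomic_replace ge in auto)
    then show ?thesis by (simp add: atomic_replace(1) minus conj_game_gsum del: wait.simps)
  next
    case (atomic_empty A B l)
    have "right_reduction K (Game (left K) (Atom (- l)))"
    proof (rule right_reduction.atomic_empty[OF atomic(1)[OF atomic_empty(2)]])
      show "upper_Rs K = upper_Ls (conj_game A)"
        using stops(1)[OF atomic(2)[OF atomic_empty(2)]] atomic_empty(3) by simp
      show "right_opts K = {|conj_game A|}"
        using arg_cong[OF atomic_empty(4), of "\<lambda>F. conj_game |`| F"] image by simp
      have "conj_game (Game (Atom l) (right (conj_game K))) \<in> GS"
        using atomic_empty(5) by (simp only: conj_game_GS)
      then show "Game (left K) (Atom (- l)) \<in> GS" by simp
    qed
    then show ?thesis by (simp add: atomic_empty(1))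
  qed
qed

text \<open>Concerns the root only. For games in \<open>GS\<close> the equivalence asked for in
  \<open>reduced\<close> is supplied by \<open>left_reduction_equiv\<close>.\<close>

definition left_irreducible :: "game \<Rightarrow> bool" where
  "left_irreducible G \<longleftrightarrow> (\<forall>G'. left_reduction G G' \<longrightarrow> G' = G)"

lemma reduced_left_irreducible:
  assumes "reduced G" "G \<in> GS"
  shows "left_irreducible G"
  using assms left_reduction_equiv followers.self unfolding reduced_def left_irreducible_def by blast

lemma reduced_left_irreducible_conj_game:
  assumes "reduced G" "G \<in> GS"
  shows "left_irreducible (conj_game G)"
  unfolding left_irreducible_def
proof (intro allI impI)
  fix G' assume red: "left_reduction (conj_game G) G'"
  have "G' \<sim> conj_game G" "G' \<in> GS"
    using left_reduction_equiv[OF _ red] left_reduction_GS[OF _ red] assms(2) by simp_all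
  then have "conj_game G' \<sim> G"
    using conj_game_equiv_conj_game[of "conj_game G'" G] assms(2) by (simp add: GS_scoring_game)
  then have "conj_game G' = G"
    using right_reduction_conj_game[OF assms(2) red] assms(1) followers.self
    unfolding reduced_def by blast
  then show "G' = conj_game G" by auto
qed

lemma reduced_follower: "reduced G \<Longrightarrow> K \<in> followers G \<Longrightarrow> reduced K"
  unfolding reduced_def using followers_trans by blast

text \<open>Provides a witness for the least \<open>n\<close> in reduction (iii): any game above
  \<open>B\<close> is above this waiting game.\<close>

lemma left_Atom_ge_neg_wait:
  assumes "B \<in> GS" "left B = Atom l"
  shows "B \<succeq> number l \<oplus> neg_wait (size B)"
  unfolding game_ge_def
proof
  fix X assume X: "X \<in> GS"
  have *: "(number l \<oplus> neg_wait (size B)) \<oplus> X = X \<oplus> (number l \<oplus> neg_wait (size B))"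
    by (rule gsum_commute)
  have "l \<le> s" if "s \<in> atoms B" for s
    using that assms GS_left_Atom by blast
  from stops_gsum_ge_neg_wait[OF X assms(1) this order_refl]
  show "Ls ((number l \<oplus> neg_wait (size B)) \<oplus> X) \<le> Ls (B \<oplus> X) \<and>
      Rs ((number l \<oplus> neg_wait (size B)) \<oplus> X) \<le> Rs (B \<oplus> X)"
    unfolding * gsum_commute[of B X]
    by (simp add: stops_gsum_number GS_scoring_game X wait_GS)
qed

text \<open>The replacement option in reduction (iii).  Its parameter is \<open>l = lower_Ls K\<close>; the \<open>LEAST\<close> is
  meaningful only when \<open>K\<close> has an atomic-reversible Left option.\<close>

definition waiting_option :: "game \<Rightarrow> game" where
  "waiting_option K = number (lower_Ls K) \<oplus>
     neg_wait (Suc (LEAST n. K \<succeq> number (lower_Ls K) \<oplus> neg_wait n))"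

text \<open>Each reduction available for \<open>A\<close> must leave \<open>K\<close> unchanged.
  Reversal through a nonempty set and atomic deletion would lose \<open>A\<close>, so
  \<open>A\<close> is atomic-reversible and alone attains the pass-allowed stop. Then replacement
  applies and must return \<open>A\<close> itself, and reduction (iv) must be blocked.\<close>

lemma irreducible_reversible_option:
  assumes K: "K \<in> GS" and "left_irreducible K"
    and rev: "left_reversible K A B"
  shows "A = waiting_option K"
    and "K \<succeq> number (lower_Ls K) \<oplus> neg_wait (LEAST n. K \<succeq> number (lower_Ls K) \<oplus> neg_wait n)"
    and "\<And>C. C |\<in>| left_opts K \<Longrightarrow> C \<noteq> A \<Longrightarrow> lower_Rs C < lower_Ls K"
    and "left_opts K = {|A|} \<Longrightarrow> Game (Atom (lower_Ls K)) (right K) \<notin> GS"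
proof -
  have irreducible: "K' = K" if "left_reduction K K'" for K'
    using that \<open>left_irreducible K\<close> by (simp add: left_irreducible_def)
  note B = left_reversibleD[OF K rev]
  \<comment> \<open>Reversal therefore really removes \<open>A\<close> and cannot reinsert it from
    \<open>B\<close>.\<close>
  have size: "A |\<notin>| left_opts B"
    using B(2) size_left_opts[of A B] size_right_opts[of B A] by auto
  have "left B \<noteq> Opts F" for F
  proof
    assume F: "left B = Opts F"
    then have "F \<noteq> {||}"
      using B(4) GS_scoring_game scoring_game_sides by blast
    from irreducible[OF left_reduction.reverse[OF rev F this]]
    have "left_opts K = left_opts K |-| {|A|} |\<union>| F"
      by (metis game.sel(1) opts.simps(2))
    then show False using B(1) size F by auto
  qed
  then obtain l where l: "left B = Atom l"
    by (cases "left B") auto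
  have atomic: "left_atomic_reversible K A B l"
    using rev l by (simp add: left_atomic_reversible_def)
  have other: "lower_Ls K \<noteq> lower_Rs C" if "C |\<in>| left_opts K" "C \<noteq> A" for C
  proof
    assume "lower_Ls K = lower_Rs C"
    from irreducible[OF left_reduction.atomic_delete[OF atomic that this]]
    have "left_opts K = left_opts K |-| {|A|}"
      by (metis game.sel(1) opts.simps(2))
    then show False using B(1) by auto
  qed
  \<comment> \<open>Some Left option attains \<open>lower_Ls K\<close>, and no option other than
    \<open>A\<close> does.\<close>
  then have A: "lower_Ls K = lower_Rs A"
    using lower_Ls_option[OF K] B(1) by blast
  show less: "lower_Rs C < lower_Ls K" if "C |\<in>| left_opts K" "C \<noteq> A" for C
    using other[OF that] lower_Rs_le_lower_Ls[OF GS_scoring_game[OF K] that(1)] by simp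
  define n where "n = (LEAST n. K \<succeq> number l \<oplus> neg_wait n)"
  have "K \<succeq> number l \<oplus> neg_wait (size B)"
    using B(3) left_Atom_ge_neg_wait[OF B(4) l] game_ge_trans by blast
  then have n: "K \<succeq> number l \<oplus> neg_wait n"
    unfolding n_def by (rule LeastI)
  have "left_reduction K
      (Game (Opts (finsert (number l \<oplus> neg_wait (n + 1)) (left_opts K |-| {|A|}))) (right K))"
    by (rule left_reduction.atomic_replace[OF atomic A])
      (use less A n in \<open>auto simp: n_def intro: Least_le\<close>)
  from irreducible[OF this]
  have "left_opts K = finsert (number l \<oplus> neg_wait (n + 1)) (left_opts K |-| {|A|})"
    by (metis game.sel(1) opts.simps(2))
  \<comment> \<open>\<open>A\<close> belongs to the new set only as the inserted option.\<close>
  then have A_eq: "A = number l \<oplus> neg_wait (n + 1)"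
    using B(1) by auto
  then have l_eq: "lower_Ls K = l"
    using A lower_Rs_number_neg_wait[of l "n + 1"] by simp
  show "A = waiting_option K"
    using A_eq by (simp add: waiting_option_def l_eq n_def)
  show "K \<succeq> number (lower_Ls K) \<oplus> neg_wait (LEAST n. K \<succeq> number (lower_Ls K) \<oplus> neg_wait n)"
    using n by (simp add: l_eq n_def)
  show "Game (Atom (lower_Ls K)) (right K) \<notin> GS" if "left_opts K = {|A|}"
  proof
    assume "Game (Atom (lower_Ls K)) (right K) \<in> GS"
    then have "left_reduction K (Game (Atom l) (right K))"
      using atomic A that l_eq by (intro left_reduction.atomic_empty) auto
    from irreducible[OF this] have "left K = Atom l"
      by (metis game.sel(1))
    then show False using B(1) by simp
  qed
qed

subsection \<open>Uniqueness of reduced forms\<close>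

lemma game_equiv_sym: "G \<sim> H \<Longrightarrow> H \<sim> G"
  by (auto simp: game_equiv_def)

text \<open>Answers are followed forth and back: \<open>A\<close> lies below some \<open>C\<close>
  in \<open>G\<close>, and \<open>C\<close> below some \<open>D\<close> in \<open>H\<close>. Absence
  of dominated options forces \<open>D = A\<close>, so \<open>C \<sim> A\<close> and the hypothesis
  on options gives equality.\<close>

lemma nonreversible_option_common:
  assumes G: "G \<in> GS" and H: "H \<in> GS" and equiv: "G \<sim> H"
    and irr_G: "left_irreducible G" and irr_H: "left_irreducible H"
    and IH: "\<And>A B. A |\<in>| left_opts G \<Longrightarrow> B |\<in>| left_opts H \<Longrightarrow> A \<sim> B \<Longrightarrow> A = B"
    and A: "A |\<in>| left_opts H" and nonrev: "\<And>B. \<not> left_reversible H A B"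
  shows "A |\<in>| left_opts G \<and> (\<forall>B. \<not> left_reversible G A B)"
proof -
  have ge: "G \<succeq> H" "H \<succeq> G" using equiv by (auto simp: game_equiv_def)
  note sG = GS_scoring_game[OF G] and sH = GS_scoring_game[OF H]
  \<comment> \<open>An answer through a Right option of \<open>A\<close> would make \<open>A\<close>
    reversible in \<open>H\<close>.\<close>
  have not_ge: "\<not> G \<succeq> B" if "B |\<in>| right_opts A" for B
    using that nonrev[of B] A game_ge_trans[OF ge(2)] by (auto simp: left_reversible_def)
  then obtain C where C: "C |\<in>| left_opts G" "C \<succeq> A"
    using game_ge_left_option[OF sG sH ge(1) A] by blast
  \<comment> \<open>A reversible \<open>C\<close> is the waiting option, with Right option
    \<open>W\<close>. As \<open>W\<close> has no Left option, \<open>C \<succeq> A\<close> can only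
    answer it by a Right option \<open>D\<close> of \<open>A\<close> with
    \<open>W \<succeq> D\<close>; then \<open>G \<succeq> D\<close>, which is excluded.\<close>
  have C_nonrev: "\<not> left_reversible G C B" for B
  proof
    assume "left_reversible G C B"
    note rev = irreducible_reversible_option(1,2)[OF G irr_G this]
    define W where
      "W = number (lower_Ls G) \<oplus> neg_wait (LEAST n. G \<succeq> number (lower_Ls G) \<oplus> neg_wait n)"
    have "W |\<in>| right_opts C"
      unfolding rev(1) waiting_option_def number_neg_wait W_def by simp
    moreover have "left_opts W = {||}"
      by (simp only: W_def number_neg_wait opts.simps)
    ultimately obtain D where "D |\<in>| right_opts A" "W \<succeq> D"
      using game_ge_right_option[OF scoring_game_left_opts[OF sG C(1)]
          scoring_game_left_opts[OF sH A] C(2)] by fastforce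
    moreover have "G \<succeq> W" using rev(2) by (simp only: W_def)
    ultimately show False using not_ge game_ge_trans by blast
  qed
  then have "\<not> H \<succeq> B" if "B |\<in>| right_opts C" for B
    using that C(1) game_ge_trans[OF ge(1)] by (auto simp: left_reversible_def)
  then obtain D where D: "D |\<in>| left_opts H" "D \<succeq> C"
    using game_ge_left_option[OF sH sG ge(2) C(1)] by blast
  have "D = A"
  proof (rule ccontr)
    assume "D \<noteq> A"
    then have "left_reduction H (Game (Opts (left_opts H |-| {|A|})) (right H))"
      using D A game_ge_trans[OF D(2) C(2)] by (intro left_reduction.dominated[of A H D]) auto
    then have "H = Game (Opts (left_opts H |-| {|A|})) (right H)"
      using irr_H unfolding left_irreducible_def by metis
    then have "left_opts H = left_opts H |-| {|A|}"
      by (metis game.sel(1) opts.simps(2))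
    then show False using A by auto
  qed
  then have "C \<sim> A" using C(2) D(2) by (simp add: game_equiv_def)
  then have "C = A" using IH C(1) A by blast
  then show ?thesis using C(1) C_nonrev by blast
qed

lemma lower_Ls_cong:
  assumes "G \<in> GS" "H \<in> GS" "G \<sim> H"
  shows "lower_Ls G = lower_Ls H"
  using assms lower_Ls_mono[of G H] lower_Ls_mono[of H G]
  by (simp add: game_equiv_def GS_scoring_game)

lemma waiting_option_cong:
  assumes "G \<in> GS" "H \<in> GS" "G \<sim> H"
  shows "waiting_option G = waiting_option H"
proof -
  have "G \<succeq> J \<longleftrightarrow> H \<succeq> J" for J
    using assms(3) game_ge_trans unfolding game_equiv_def by blast
  then show ?thesis
    by (simp add: waiting_option_def lower_Ls_cong[OF assms])
qed

text \<open>For a reversible \<open>A\<close> of \<open>H\<close>, take an option \<open>C\<close>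
  of \<open>G\<close> attaining the common pass-allowed stop. If \<open>C\<close> were not
  reversible it would be an option of \<open>H\<close> other than \<open>A\<close> attaining that
  stop, which is impossible. Hence \<open>C\<close> and \<open>A\<close> are both the waiting
  option.\<close>

lemma irreducible_left_opts_subset:
  assumes G: "G \<in> GS" and H: "H \<in> GS" and equiv: "G \<sim> H"
    and irr_G: "left_irreducible G" and irr_H: "left_irreducible H"
    and IH: "\<And>A B. A |\<in>| left_opts G \<Longrightarrow> B |\<in>| left_opts H \<Longrightarrow> A \<sim> B \<Longrightarrow> A = B"
    and nonempty: "left_opts G \<noteq> {||}"
  shows "left_opts H |\<subseteq>| left_opts G"
proof
  fix A assume A: "A |\<in>| left_opts H"
  show "A |\<in>| left_opts G"
  proof (cases "\<exists>B. left_reversible H A B")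
    case False
    then show ?thesis
      using nonreversible_option_common[OF G H equiv irr_G irr_H IH A] by blast
  next
    case True
    then obtain B where B: "left_reversible H A B" by blast
    obtain C where C: "C |\<in>| left_opts G" "lower_Ls G = lower_Rs C"
      using lower_Ls_option[OF G nonempty] by blast
    have "\<exists>B. left_reversible G C B"
    proof (rule ccontr)
      assume "\<nexists>B. left_reversible G C B"
      then have "C |\<in>| left_opts H" "\<not> left_reversible H C B"
        using nonreversible_option_common[OF H G game_equiv_sym[OF equiv] irr_H irr_G _ C(1)]
          IH game_equiv_sym by blast+
      then have "lower_Rs C < lower_Ls H"
        using irreducible_reversible_option(3)[OF H irr_H B] B by blast
      then show False
        using C(2) lower_Ls_cong[OF G H equiv] by simp
    qed
    then have "C = waiting_option G"
      using irreducible_reversible_option(1)[OF G irr_G] by blast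
    also have "\<dots> = A"
      using irreducible_reversible_option(1)[OF H irr_H B] waiting_option_cong[OF G H equiv] by simp
    finally show ?thesis using C(1) by simp
  qed
qed

text \<open>The only way in which the Left sides can still differ; the last conjunct says that
  reduction (iv) is blocked for \<open>H\<close>.\<close>

definition left_atom_mismatch :: "game \<Rightarrow> game \<Rightarrow> bool" where
  "left_atom_mismatch G H \<longleftrightarrow>
     (\<exists>l n. left G = Atom l \<and> left H = Opts {|number l \<oplus> neg_wait n|} \<and> Game (Atom l) (right H) \<notin> GS)"

text \<open>\<open>G\<close> has no Left option to share, so every Left option of \<open>H\<close>
  is reversible. All of them coincide with the waiting option, and it stands alone.\<close>

lemma irreducible_left_atom_mismatch:
  assumes G: "G \<in> GS" and H: "H \<in> GS" and equiv: "G \<sim> H"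
    and irr_G: "left_irreducible G" and irr_H: "left_irreducible H"
    and l: "left G = Atom l" and F: "left H = Opts F"
  shows "left_atom_mismatch G H"
proof -
  have rev: "\<exists>B. left_reversible H A B" if "A |\<in>| left_opts H" for A
    using nonreversible_option_common[OF G H equiv irr_G irr_H _ that] l by fastforce
  have opt: "A = waiting_option H" if "A |\<in>| left_opts H" for A
    using rev[OF that] irreducible_reversible_option(1)[OF H irr_H] by blast
  have "F \<noteq> {||}"
    using F H GS_scoring_game scoring_game_sides by blast
  then obtain A where A: "A |\<in>| left_opts H" using F by auto
  then have single: "left_opts H = {|waiting_option H|}"
    using opt by (auto intro: fset_eqI)
  have "lower_Ls H = l"
    using lower_Ls_cong[OF G H equiv] lower_Ls_Atom[OF l] by simp
  moreover have "Game (Atom (lower_Ls H)) (right H) \<notin> GS"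
    using rev[OF A] irreducible_reversible_option(4)[OF H irr_H] opt[OF A] single by blast
  moreover obtain n where "waiting_option H = number (lower_Ls H) \<oplus> neg_wait n"
    using waiting_option_def by blast
  ultimately show ?thesis
    using l F single unfolding left_atom_mismatch_def by auto
qed

lemma irreducible_left_cases:
  assumes G: "G \<in> GS" and H: "H \<in> GS" and equiv: "G \<sim> H"
    and irr_G: "left_irreducible G" and irr_H: "left_irreducible H"
    and IH: "\<And>A B. A |\<in>| left_opts G \<Longrightarrow> B |\<in>| left_opts H \<Longrightarrow> A \<sim> B \<Longrightarrow> A = B"
  shows "left G = left H \<or> left_atom_mismatch G H \<or> left_atom_mismatch H G"
proof (cases "left G")
  case l: (Atom l)
  show ?thesis
  proof (cases "left H")
    case (Atom h)
    then show ?thesis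
      using l lower_Ls_cong[OF G H equiv] lower_Ls_Atom[of G l] lower_Ls_Atom[of H h] by simp
  next
    case (Opts F)
    then show ?thesis
      using irreducible_left_atom_mismatch[OF G H equiv irr_G irr_H l] by blast
  qed
next
  case E: (Opts E)
  show ?thesis
  proof (cases "left H")
    case (Atom h)
    then show ?thesis
      using irreducible_left_atom_mismatch[OF H G game_equiv_sym[OF equiv] irr_H irr_G _ E] by blast
  next
    case (Opts F)
    have "left_opts G \<noteq> {||}" "left_opts H \<noteq> {||}"
      using E Opts scoring_game_sides(1)[OF GS_scoring_game[OF G]]
        scoring_game_sides(1)[OF GS_scoring_game[OF H]] by auto
    moreover have "B = A" if "A |\<in>| left_opts G" "B |\<in>| left_opts H" "B \<sim> A" for A B
      using IH that game_equiv_sym by blast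
    ultimately have "left_opts H |\<subseteq>| left_opts G" "left_opts G |\<subseteq>| left_opts H"
      using irreducible_left_opts_subset[OF G H equiv irr_G irr_H IH]
        irreducible_left_opts_subset[OF H G game_equiv_sym[OF equiv] irr_H irr_G] by blast+
    then show ?thesis using E Opts by auto
  qed
qed

section \<open>Excluding the mismatch and conclusion\<close>

lemma right_atom_mismatch:
  assumes "left_atom_mismatch (conj_game G) (conj_game H)"
  obtains r n where "right G = Atom r" "right H = Opts {|number r \<oplus> wait n|}"
    "Game (left H) (Atom r) \<notin> GS"
proof -
  obtain l n where l: "right G = Atom (- l)"
    and H: "conj_side (right H) = Opts {|number l \<oplus> neg_wait n|}"
    and GS: "Game (Atom l) (conj_side (left H)) \<notin> GS"
    using assms by (auto simp: left_atom_mismatch_def)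
  have "right H = Opts {|number (- l) \<oplus> wait n|}"
    using arg_cong[OF H, of conj_side] by (simp add: conj_game_gsum)
  moreover have "Game (left H) (Atom (- l)) \<notin> GS"
    using GS conj_game_GS[of "Game (left H) (Atom (- l))"] by simp
  ultimately show ?thesis using that l by blast
qed

text \<open>Reduction (iv) could be blocked only by an atom on the Right of \<open>H\<close> below
  \<open>l\<close>. But \<open>right H\<close> is either \<open>right G\<close> or has the single
  atom \<open>r\<close>, which also occurs in \<open>G\<close>; and \<open>l\<close> bounds the
  atoms of the guaranteed game \<open>G\<close> from below.\<close>

lemma no_left_atom_mismatch:
  assumes "G \<in> GS" "H \<in> GS"
    and right: "right G = right H \<or> left_atom_mismatch (conj_game G) (conj_game H)
      \<or> left_atom_mismatch (conj_game H) (conj_game G)"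
  shows "\<not> left_atom_mismatch G H"
proof
  assume "left_atom_mismatch G H"
  then obtain l where l: "left G = Atom l" and notin: "Game (Atom l) (right H) \<notin> GS"
    by (auto simp: left_atom_mismatch_def)
  have atom: "l \<le> s" if "s \<in> atoms G" for s
    using assms(1) l that by (rule GS_left_Atom)
  from right have "Game (Atom l) (right H) \<in> GS"
  proof (elim disjE)
    assume "right G = right H"
    then show ?thesis using assms(1) l by (metis game.collapse)
  next
    assume "left_atom_mismatch (conj_game G) (conj_game H)"
    then obtain r n where r: "right G = Atom r" "right H = Opts {|number r \<oplus> wait n|}"
      by (rule right_atom_mismatch)
    then have "l \<le> r" using atom atoms_right_Atom by blast
    moreover have "s = l \<or> s = r" if "s \<in> atoms (Game (Atom l) (right H))" for s
      using that r atoms_number_wait by (subst (asm) atoms_unfold) auto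
    ultimately show ?thesis
      using r gsum_GS number_GS wait_GS by (intro GS_GameI) auto
  next
    assume "left_atom_mismatch (conj_game H) (conj_game G)"
    then obtain r n where r: "right H = Atom r" "right G = Opts {|number r \<oplus> wait n|}"
      by (rule right_atom_mismatch)
    have "right (number r \<oplus> wait n) = Atom r" "number r \<oplus> wait n |\<in>| right_opts G"
      using r(2) by (simp_all add: right_gsum_eq_Atom number_def)
    then have "r \<in> atoms G"
      using atoms_right_Atom atoms_follower followers_right by blast
    then have "l \<le> r" by (rule atom)
    moreover have "s = l \<or> s = r" if "s \<in> atoms (Game (Atom l) (right H))" for s
      using that r by (subst (asm) atoms_unfold) auto
    ultimately show ?thesis
      using r by (intro GS_GameI) auto
  qed
  with notin show False ..
qed

theorem theorem42:
  fixes G H :: game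
  assumes "G \<in> GS" and "H \<in> GS"
    and "G \<sim> H"
    and "reduced G" and "reduced H"
  shows "G = H"
  using assms
proof (induction "size G + size H" arbitrary: G H rule: less_induct)
  case less
  have IH: "A = B"
    if "A |\<in>| left_opts G \<and> B |\<in>| left_opts H \<or> A |\<in>| right_opts G \<and> B |\<in>| right_opts H" "A \<sim> B"
    for A B
  proof (rule less.hyps)
    show "size A + size B < size G + size H"
      using that(1) by (auto dest!: size_left_opts size_right_opts)
    show "A \<in> GS" "B \<in> GS"
      using that(1) less.prems(1,2) GS_left_opts GS_right_opts by blast+
    show "reduced A" "reduced B"
      using that(1) less.prems(4,5) reduced_follower followers_left followers_right by blast+
  qed (rule that(2))
  note scoring = less.prems(1,2)[THEN GS_scoring_game]
  have left: "left G = left H \<or> left_atom_mismatch G H \<or> left_atom_mismatch H G"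
    using less.prems IH by (intro irreducible_left_cases reduced_left_irreducible) blast+
  \<comment> \<open>The Right sides are compared by running the Left argument on the
    conjugates.\<close>
  have "left (conj_game G) = left (conj_game H) \<or> left_atom_mismatch (conj_game G) (conj_game H)
      \<or> left_atom_mismatch (conj_game H) (conj_game G)"
  proof (rule irreducible_left_cases)
    show "conj_game G \<sim> conj_game H"
      using less.prems(3) scoring by (simp add: conj_game_equiv_conj_game)
    show "A = B" if A: "A |\<in>| left_opts (conj_game G)" and B: "B |\<in>| left_opts (conj_game H)"
      and "A \<sim> B" for A B
    proof -
      have "scoring_game A" "scoring_game B"
        using A B scoring scoring_game_left_opts scoring_game_conj_game by blast+
      then have "conj_game A = conj_game B"
        using A B \<open>A \<sim> B\<close> by (intro IH) (auto simp: conj_game_equiv_conj_game)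
      then show ?thesis by simp
    qed
  qed (use less.prems reduced_left_irreducible_conj_game in auto)
  then have right: "right G = right H \<or> left_atom_mismatch (conj_game G) (conj_game H)
      \<or> left_atom_mismatch (conj_game H) (conj_game G)"
    by (metis conj_conj_side left_conj_game)
  have "left G = left H"
    using left right no_left_atom_mismatch[of G H] no_left_atom_mismatch[of H G] less.prems
    by metis
  \<comment> \<open>Once the Left sides agree, the game that a Right mismatch declares not
    guaranteed is \<open>G\<close> or \<open>H\<close> itself.\<close>
  moreover have "right G = right H"
    using right
  proof (elim disjE)
    assume "left_atom_mismatch (conj_game G) (conj_game H)"
    then obtain r where "right G = Atom r" "Game (left H) (Atom r) \<notin> GS"
      by (rule right_atom_mismatch)
    then show ?thesis using less.prems(1) \<open>left G = left H\<close> by (metis game.collapse)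
  next
    assume "left_atom_mismatch (conj_game H) (conj_game G)"
    then obtain r where "right H = Atom r" "Game (left G) (Atom r) \<notin> GS"
      by (rule right_atom_mismatch)
    then show ?thesis using less.prems(2) \<open>left G = left H\<close> by (metis game.collapse)
  qed
  ultimately show ?case by (simp add: game.expand)
qed

end
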